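(* Let $n\ge 3$ and let $F$ be a face of the Whitehouse complex $\Delta_n$. Then $\mathrm{link}_{\Delta_n}(F)$ is homotopy equivalent to a wedge of $(c-1)!\cdot\prod_{T\in F}(c(T)-1)!$ spheres of dimension $n-4-|F|$, where $c$ is the number of connected components of the forest representation of $F$ and $c(T)$ is the number of children of the node $T$ in that forest.
   Context: The Whitehouse complex $\Delta_n$ ($n\ge 3$) is the simplicial complex with vertex set $V_n=\{S\subseteq\{2,\dots,n\}: 2\le |S|\le n-2\}$, in which a subset $F\subseteq V_n$ is a face iff for all $S,T\in F$ one has $S\subseteq T$, $T\subseteq S$, or $S\cap T=\emptyset$. Convention: the complex $\{\emptyset\}$ is regarded as the $(-1)$-dimensional sphere. The forest representation of a face $F$ is the rooted forest with node set $\{2,\dots,n\}\cup F$ (the elements $2,\dots,n$ are the leaves) in which the children of $S\in F$ are: the sets $U\in F$ with $U\subsetneq S$ such that no $W\in F$ satisfies $U\subsetneq W\subsetneq S$, and the elements $i\in S$ such that no $U\in F$ satisfies $i\in U\subsetneq S$. Its roots (one per component) are the inclusion-maximal elements of $F$ together with the elements of $\{2,\dots,n\}$ lying in no element of $F$. The link of $F$ is $\{G: F\cap G=\emptyset, F\cup G\in\Delta_n\}$. *)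

theory Defs
  imports "HOL-Analysis.Analysis"
begin

definition whitehouse_vertices :: "nat \<Rightarrow> nat set set" where
  "whitehouse_vertices n = {S. S \<subseteq> {2..n} \<and> 2 \<le> card S \<and> card S \<le> n - 2}"

definition whitehouse_complex :: "nat \<Rightarrow> nat set set set" where
  "whitehouse_complex n = {F. F \<subseteq> whitehouse_vertices n \<and>
      (\<forall>S\<in>F. \<forall>T\<in>F. S \<subseteq> T \<or> T \<subseteq> S \<or> S \<inter> T = {})}"

definition link :: "'v set set \<Rightarrow> 'v set \<Rightarrow> 'v set set" where
  "link K F = {G. F \<inter> G = {} \<and> F \<union> G \<in> K}"

text \<open>Number of connected components (= number of roots) of the forest representation
  of the face F of the Whitehouse complex on leaves 2..n.\<close>
definition forest_components :: "nat \<Rightarrow> nat set set \<Rightarrow> nat" where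
  "forest_components n F =
     card {S\<in>F. \<not> (\<exists>T\<in>F. S \<subset> T)} + card {i\<in>{2..n}. \<forall>S\<in>F. i \<notin> S}"

definition forest_children :: "nat set set \<Rightarrow> nat set \<Rightarrow> nat" where
  "forest_children F S =
     card {U\<in>F. U \<subset> S \<and> \<not> (\<exists>W\<in>F. U \<subset> W \<and> W \<subset> S)}
   + card {i\<in>S. \<not> (\<exists>U\<in>F. i \<in> U \<and> U \<subset> S)}"

text \<open>Geometric realization of a finite abstract simplicial complex K (a set of finite
  vertex sets, closed under subsets): functions with finite support in K, nonnegative,
  summing to 1, with the topology induced from the product topology (which on functions
  supported on a finite set is the Euclidean topology).\<close>
definition realization :: "'v set set \<Rightarrow> ('v \<Rightarrow> real) topology" where
  "realization K = subtopology (powertop_real UNIV)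
     {f. {v. f v \<noteq> 0} \<in> K \<and> (\<forall>v. 0 \<le> f v) \<and> sum f {v. f v \<noteq> 0} = 1}"

text \<open>A concrete model of the wedge of k spheres of dimension d \<ge> 0: the union of the
  k d-spheres in R^(d+1) given by |x|^2 = 2 j x_0 (j = 1..k), which pairwise meet only
  at the origin, together with the origin (so that k = 0 gives a point).\<close>
definition wedge_of_spheres :: "nat \<Rightarrow> nat \<Rightarrow> (nat \<Rightarrow> real) topology" where
  "wedge_of_spheres k d = subtopology (powertop_real UNIV)
     {x. (\<forall>i>d. x i = 0) \<and>
         (x = (\<lambda>_. 0) \<or> (\<exists>j\<in>{1..k}. (\<Sum>i\<le>d. (x i)\<^sup>2) = 2 * real j * x 0))}"

text \<open>"K is homotopy equivalent to a wedge of k spheres of dimension d" (d \<ge> -1),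
  where by convention the only complex that is a wedge of (-1)-spheres is
  the (-1)-sphere {\<emptyset>} itself, which is a wedge of exactly one (-1)-sphere.\<close>
definition is_wedge_of_spheres :: "'v set set \<Rightarrow> nat \<Rightarrow> int \<Rightarrow> bool" where
  "is_wedge_of_spheres K k d =
     (if d = -1 then K = {{}} \<and> k = 1
      else 0 \<le> d \<and> realization K homotopy_equivalent_space wedge_of_spheres k (nat d))"

end

(* A finite complex of dimension d which becomes collapsible after removing k of its d-dimensional
   facets is homotopy equivalent to a wedge of k d-spheres: contract the collapsible subcomplex to a point.
   This property passes from the link and the deletion of a vertex to the complex, adding up k.

   Add the set V = {2..n} and all singletons to F. The link of F consists of the sets G for which the
   resulting hierarchy H together with G is still a hierarchy. If every node of H has at most two children,
   then H is maximal and the link is {{}}. Otherwise take a node T with m >= 3 children and one child a,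
   and delete, in increasing order, the vertices S with a < S < T. The link of S in what remains is a cone
   with apex S - a, except when S is the union of a and one of its m - 1 siblings, when it is the link of
   F together with S, where T has lost a child and S has two. Finally a cone with apex T - a remains. So T
   contributes the factor m - 1 and, inductively, (m - 1)!. *)
theory Submission
  imports Defs
begin

section \<open>Collapsible complexes\<close>

text \<open>Collapses run down to the void family, so the empty face is matched too. The families
  need not be closed under subsets, which lets the collapses of a link, with the vertex added to
  each face, precede those of the deletion. The order of deletion matters because a set compatible
  with \<open>S\<close> and \<open>a\<close> is compatible with \<open>S - a\<close> unless it lies
  strictly between \<open>a\<close> and \<open>S\<close>. Three children are required so that
  \<open>T - a\<close> is not yet a node and \<open>a \<union> b\<close> is smaller than
  \<open>T\<close>. On the topological side, contracting a subcomplex is a homotopy equivalence only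
  through homotopy extension, and the target is a concrete union of spheres, not an abstract
  quotient. Both are handled by formulas: the least barycentric coordinate of a top face vanishes
  off its open simplex, so sums over the removed faces give continuous maps, and a continuous
  surjection from a compact to a Hausdorff space is already a quotient map.\<close>

inductive collapsible :: "'v set set \<Rightarrow> bool" where
  empty: "collapsible {}"
| step: "\<lbrakk>\<sigma> \<in> K; v \<notin> \<sigma>; insert v \<sigma> \<in> K; \<And>\<rho>. \<rho> \<in> K \<Longrightarrow> \<sigma> \<subseteq> \<rho> \<Longrightarrow> \<rho> = \<sigma> \<or> \<rho> = insert v \<sigma>;
          collapsible (K - {\<sigma>, insert v \<sigma>})\<rbrakk> \<Longrightarrow> collapsible K"

text \<open>A maximal face among those avoiding \<open>v\<close> can be collapsed together with its
  join with \<open>v\<close>, and what is left is still closed under adding and removing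
  \<open>v\<close>.\<close>

lemma collapsible_cone:
  assumes "finite K" "\<And>\<sigma>. \<sigma> \<in> K \<Longrightarrow> insert v \<sigma> \<in> K \<and> \<sigma> - {v} \<in> K"
  shows "collapsible K"
  using assms
proof (induction K rule: finite_psubset_induct)
  case (psubset K)
  show ?case
  proof (cases "K = {}")
    case True
    then show ?thesis by (simp add: collapsible.empty)
  next
    case False
    then have "{\<sigma> \<in> K. v \<notin> \<sigma>} \<noteq> {}" using psubset.prems by blast
    then obtain \<sigma> where \<sigma>: "\<sigma> \<in> K" "v \<notin> \<sigma>"
      and max: "\<And>\<rho>. \<rho> \<in> K \<Longrightarrow> v \<notin> \<rho> \<Longrightarrow> \<sigma> \<subseteq> \<rho> \<Longrightarrow> \<rho> = \<sigma>"
      using finite_has_maximal[of "{\<sigma> \<in> K. v \<notin> \<sigma>}"] psubset.hyps by auto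
    show ?thesis
    proof (rule collapsible.step[of \<sigma> K v])
      show "insert v \<sigma> \<in> K" using psubset.prems \<sigma> by blast
      show "\<rho> = \<sigma> \<or> \<rho> = insert v \<sigma>" if \<rho>: "\<rho> \<in> K" "\<sigma> \<subseteq> \<rho>" for \<rho>
      proof -
        \<comment> \<open>\<open>\<rho> - {v}\<close> lies in \<open>K\<close>, avoids
          \<open>v\<close> and still contains \<open>\<sigma>\<close>, so maximality applies to
          it.\<close>
        have "\<rho> - {v} = \<sigma>" using psubset.prems max[of "\<rho> - {v}"] \<rho> \<sigma> by blast
        then show ?thesis by blast
      qed
      show "collapsible (K - {\<sigma>, insert v \<sigma>})"
      proof (rule psubset.IH)
        show "K - {\<sigma>, insert v \<sigma>} \<subset> K" using \<sigma> by blast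
        show "insert v \<tau> \<in> K - {\<sigma>, insert v \<sigma>} \<and> \<tau> - {v} \<in> K - {\<sigma>, insert v \<sigma>}"
          if "\<tau> \<in> K - {\<sigma>, insert v \<sigma>}" for \<tau>
        proof -
          have "insert v \<tau> \<noteq> \<sigma>" "\<tau> - {v} \<noteq> insert v \<sigma>" using \<sigma> by auto
          moreover have "insert v \<tau> \<noteq> insert v \<sigma>"
            using that \<sigma> by (metis DiffE insertCI insert_absorb insert_ident)
          moreover have "\<tau> - {v} \<noteq> \<sigma>" using that by auto
          ultimately show ?thesis using that psubset.prems[of \<tau>] by simp
        qed
      qed
    qed (use \<sigma> in auto)
  qed
qed

text \<open>Each collapse of \<open>L\<close> stays a collapse after \<open>v\<close> is added to
  its faces: the faces of \<open>D\<close> avoid \<open>v\<close> and so cannot contain the lifted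
  free face. Once \<open>L\<close> is exhausted, \<open>D\<close> remains.\<close>

lemma collapsible_link_deletion:
  assumes "collapsible L" "collapsible D" "v \<notin> \<Union>L" "v \<notin> \<Union>D"
  shows "collapsible (D \<union> insert v ` L)"
  using assms
proof (induction L rule: collapsible.induct)
  case empty
  then show ?case by simp
next
  case (step \<sigma> L w)
  have v: "v \<notin> \<sigma>" "v \<noteq> w" using step by auto
  have eq: "D \<union> insert v ` L - {insert v \<sigma>, insert w (insert v \<sigma>)}
          = D \<union> insert v ` (L - {\<sigma>, insert w \<sigma>})" (is "?l = ?r")
  proof
    show "?l \<subseteq> ?r" by (auto simp: insert_commute)
    have "insert v \<rho> \<noteq> insert v \<sigma>" "insert v \<rho> \<noteq> insert w (insert v \<sigma>)"
      if "\<rho> \<in> L - {\<sigma>, insert w \<sigma>}" for \<rho>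
    proof -
      have "v \<notin> \<rho>" using that step.prems by blast
      moreover have "v \<notin> insert w \<sigma>" using v by blast
      ultimately show "insert v \<rho> \<noteq> insert v \<sigma>" "insert v \<rho> \<noteq> insert w (insert v \<sigma>)"
        using that v by (simp_all add: insert_ident insert_commute[of w v])
    qed
    then show "?r \<subseteq> ?l" using step.prems by auto
  qed
  show ?case
  proof (rule collapsible.step[of "insert v \<sigma>" _ w])
    show "insert v \<sigma> \<in> D \<union> insert v ` L" using step.hyps by blast
    show "w \<notin> insert v \<sigma>" using v step.hyps by blast
    show "insert w (insert v \<sigma>) \<in> D \<union> insert v ` L"
      using step.hyps by (simp add: insert_commute)
    show "\<rho> = insert v \<sigma> \<or> \<rho> = insert w (insert v \<sigma>)"
      if \<rho>: "\<rho> \<in> D \<union> insert v ` L" "insert v \<sigma> \<subseteq> \<rho>" for \<rho>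
    proof -
      have "\<rho> \<notin> D" using \<rho> step.prems by blast
      then obtain \<tau> where \<tau>: "\<tau> \<in> L" "\<rho> = insert v \<tau>" using \<rho> by blast
      then have "\<tau> = \<sigma> \<or> \<tau> = insert w \<sigma>" using \<rho> v step.hyps(4)[of \<tau>] by blast
      then show ?thesis using \<tau> by (auto simp: insert_commute)
    qed
    show "collapsible (D \<union> insert v ` L - {insert v \<sigma>, insert w (insert v \<sigma>)})"
      unfolding eq using step by blast
  qed
qed

text \<open>\<open>r\<close> is a number of vertices, one more than the dimension, so that
  \<open>r = 0\<close> covers the (-1)-sphere. The bound on all faces makes the removed ones
  top-dimensional.\<close>

definition collapsible_mod :: "'v set set \<Rightarrow> nat \<Rightarrow> nat \<Rightarrow> bool" where
  "collapsible_mod K k r \<longleftrightarrow> (\<forall>\<sigma>\<in>K. card \<sigma> \<le> r) \<and>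
     (\<exists>\<Phi>\<subseteq>K. finite \<Phi> \<and> card \<Phi> = k \<and> (\<forall>\<sigma>\<in>\<Phi>. card \<sigma> = r) \<and> collapsible (K - \<Phi>))"

lemma collapsible_mod_link_deletion:
  assumes L: "collapsible_mod L k r" and D: "collapsible_mod D l (Suc r)"
    and v: "v \<notin> \<Union>L" "v \<notin> \<Union>D" and fin: "\<And>\<sigma>. \<sigma> \<in> L \<Longrightarrow> finite \<sigma>"
  shows "collapsible_mod (D \<union> insert v ` L) (k + l) (Suc r)"
proof -
  obtain \<Phi> where \<Phi>: "\<Phi> \<subseteq> L" "finite \<Phi>" "card \<Phi> = k" "\<forall>\<sigma>\<in>\<Phi>. card \<sigma> = r" "collapsible (L - \<Phi>)"
    using L by (auto simp: collapsible_mod_def)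
  obtain \<Psi> where \<Psi>: "\<Psi> \<subseteq> D" "finite \<Psi>" "card \<Psi> = l" "\<forall>\<sigma>\<in>\<Psi>. card \<sigma> = Suc r"
      "collapsible (D - \<Psi>)"
    using D by (auto simp: collapsible_mod_def)
  have inj: "inj_on (insert v) L" using v unfolding inj_on_def by (metis UnionI insert_ident)
  have card_ins: "card (insert v \<sigma>) = Suc (card \<sigma>)" if "\<sigma> \<in> L" for \<sigma>
    using that v fin by (subst card_insert_disjoint) auto
  have disj: "D \<inter> insert v ` L = {}" using v by blast
  let ?\<Xi> = "\<Psi> \<union> insert v ` \<Phi>"
  have "D \<union> insert v ` L - ?\<Xi> = (D - \<Psi>) \<union> insert v ` (L - \<Phi>)"
    using disj \<Phi>(1) \<Psi>(1) by (subst inj_on_image_set_diff[OF inj]) blast+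
  then have "collapsible (D \<union> insert v ` L - ?\<Xi>)"
    using collapsible_link_deletion[OF \<Phi>(5) \<Psi>(5), of v] v by auto
  moreover have "card ?\<Xi> = k + l"
  proof (subst card_Un_disjoint)
    show "\<Psi> \<inter> insert v ` \<Phi> = {}" using disj \<Phi>(1) \<Psi>(1) by blast
  qed (use \<Phi> \<Psi> card_image[OF inj_on_subset[OF inj \<Phi>(1)]] in auto)
  moreover have "\<forall>\<sigma>\<in>?\<Xi>. card \<sigma> = Suc r"
    using \<Phi> \<Psi> card_ins by auto
  moreover have "\<forall>\<sigma>\<in>D \<union> insert v ` L. card \<sigma> \<le> Suc r"
    using L D card_ins by (auto simp: collapsible_mod_def)
  moreover have "?\<Xi> \<subseteq> D \<union> insert v ` L" "finite ?\<Xi>" using \<Phi> \<Psi> by auto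
  ultimately show ?thesis unfolding collapsible_mod_def by blast
qed

lemma collapsible_mod_cone:
  assumes "finite K" "\<And>\<sigma>. \<sigma> \<in> K \<Longrightarrow> insert v \<sigma> \<in> K \<and> \<sigma> - {v} \<in> K" "\<And>\<sigma>. \<sigma> \<in> K \<Longrightarrow> card \<sigma> \<le> r"
  shows "collapsible_mod K 0 r"
  unfolding collapsible_mod_def using collapsible_cone[OF assms(1,2)] assms(3)
  by (auto intro!: exI[of _ "{}"])

lemma collapsible_mod_singleton_empty: "collapsible_mod {{}} (Suc 0) 0"
  unfolding collapsible_mod_def by (auto intro!: exI[of _ "{{}}"] collapsible.empty)

text \<open>Only the empty face has no vertices, and \<open>{{}}\<close> is not collapsible because
  an elementary collapse removes two faces; so the empty face is counted by
  \<open>k\<close>.\<close>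

lemma collapsible_mod_0:
  assumes K: "collapsible_mod K k 0" and "{} \<in> K" and fin: "\<And>\<sigma>. \<sigma> \<in> K \<Longrightarrow> finite \<sigma>"
  shows "K = {{}} \<and> k = 1"
proof -
  have K': "K = {{}}"
    using assms by (auto simp: collapsible_mod_def)
  have "\<not> collapsible {{} :: 'a set}"
    by (auto elim: collapsible.cases)
  then show ?thesis
    using K unfolding K' collapsible_mod_def by (auto simp: subset_singleton_iff)
qed

section \<open>Refinements of a hierarchy\<close>

definition compatible :: "'a set \<Rightarrow> 'a set \<Rightarrow> bool" where
  "compatible S T \<longleftrightarrow> S \<subseteq> T \<or> T \<subseteq> S \<or> S \<inter> T = {}"

lemma compatible_sym: "compatible S T \<Longrightarrow> compatible T S"
  by (auto simp: compatible_def)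

text \<open>With the whole set and the singletons adjoined, every node that is not a singleton is
  partitioned by its children, and leaves need no separate treatment.\<close>

definition hierarchy :: "'a set \<Rightarrow> 'a set set \<Rightarrow> bool" where
  "hierarchy V H \<longleftrightarrow> H \<subseteq> Pow V - {{}} \<and> V \<in> H \<and> (\<forall>i\<in>V. {i} \<in> H) \<and> (\<forall>S\<in>H. \<forall>T\<in>H. compatible S T)"

definition children :: "'a set set \<Rightarrow> 'a set \<Rightarrow> 'a set set" where
  "children H T = {U\<in>H. U \<subset> T \<and> \<not> (\<exists>W\<in>H. U \<subset> W \<and> W \<subset> T)}"

definition refinements :: "'a set \<Rightarrow> 'a set set \<Rightarrow> 'a set set set" where
  "refinements V H = {G. H \<inter> G = {} \<and> hierarchy V (H \<union> G)}"

lemma childrenD: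
  assumes "U \<in> children H T"
  shows "U \<in> H" "U \<subset> T" "W \<in> H \<Longrightarrow> U \<subset> W \<Longrightarrow> \<not> W \<subset> T"
  using assms by (auto simp: children_def)

section \<open>Counting the nodes of a hierarchy\<close>

context
  fixes V :: "'a set" and H :: "'a set set"
  assumes V: "finite V" and H: "hierarchy V H"
begin

lemma hierarchyD:
  shows "S \<in> H \<Longrightarrow> S \<subseteq> V" "S \<in> H \<Longrightarrow> S \<noteq> {}" "V \<in> H" "i \<in> V \<Longrightarrow> {i} \<in> H"
    "S \<in> H \<Longrightarrow> T \<in> H \<Longrightarrow> compatible S T"
  using H by (auto simp: hierarchy_def)

lemma hierarchy_finite: "finite H"
proof (rule finite_subset)
  show "H \<subseteq> Pow V" using hierarchyD(1) by blast
qed (use V in simp)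

lemma finite_children: "finite (children H T)"
  using hierarchy_finite by (simp add: children_def)

lemma children_disjoint:
  assumes "U \<in> children H T" "U' \<in> children H T" "U \<noteq> U'"
  shows "U \<inter> U' = {}"
proof -
  have "compatible U U'" using hierarchyD(5) assms childrenD(1) by metis
  moreover have "\<not> U \<subset> U'" "\<not> U' \<subset> U"
    using assms childrenD by metis+
  ultimately show ?thesis using assms(3) unfolding compatible_def by blast
qed

lemma Union_children:
  assumes T: "T \<in> H" "T \<noteq> {i}" and i: "i \<in> T"
  shows "\<exists>U\<in>children H T. i \<in> U"
proof -
  let ?A = "{U\<in>H. i \<in> U \<and> U \<subset> T}"
  have "{i} \<in> ?A" using T i hierarchyD(1,4) by blast
  then obtain U where U: "U \<in> ?A" "\<And>W. W \<in> ?A \<Longrightarrow> U \<subseteq> W \<Longrightarrow> U = W"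
    using finite_has_maximal[of ?A] hierarchy_finite by auto
  then have "U \<in> children H T" unfolding children_def by blast
  with U show ?thesis by blast
qed

lemma two_le_card_children:
  assumes T: "T \<in> H" "\<And>i. T \<noteq> {i}"
  shows "2 \<le> card (children H T)"
proof (rule ccontr)
  assume "\<not> ?thesis"
  moreover obtain i where "i \<in> T" using hierarchyD(2)[OF T(1)] by blast
  then have "children H T \<noteq> {}" using Union_children[OF T(1) T(2)] by blast
  then have "card (children H T) \<noteq> 0" using finite_children by auto
  ultimately have "card (children H T) = 1" by linarith
  then obtain U where U: "children H T = {U}" by (meson card_1_singletonE)
  then have "T \<subseteq> U" using Union_children[OF T(1) T(2)] by blast
  moreover have "U \<subset> T" using U childrenD(2)[of U H T] by blast
  ultimately show False by blast
qed

lemma children_singleton: "children H {i} = {}"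
  using hierarchyD(2) by (auto simp: children_def)

text \<open>Double counting of the pairs (child, parent): every node other than \<^term>\<open>V\<close> has exactly
  one parent.\<close>

lemma sum_card_children: "(\<Sum>T\<in>H. card (children H T)) + 1 = card H"
proof -
  have "(\<Union>T\<in>H. children H T) = H - {V}"
  proof
    show "(\<Union>T\<in>H. children H T) \<subseteq> H - {V}"
      using hierarchyD(1) by (auto simp: children_def)
    show "H - {V} \<subseteq> (\<Union>T\<in>H. children H T)"
    proof
      fix S assume S: "S \<in> H - {V}"
      let ?A = "{T\<in>H. S \<subset> T}"
      have "V \<in> ?A" using S hierarchyD(1,3) by blast
      then obtain T where "T \<in> ?A" "\<And>W. W \<in> ?A \<Longrightarrow> W \<subseteq> T \<Longrightarrow> T = W"
        using finite_has_minimal[of ?A] hierarchy_finite by auto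
      then have "T \<in> H" "S \<in> children H T" using S unfolding children_def by blast+
      then show "S \<in> (\<Union>T\<in>H. children H T)" by blast
    qed
  qed
  moreover have "card (\<Union>T\<in>H. children H T) = (\<Sum>T\<in>H. card (children H T))"
  proof (rule card_UN_disjoint)
    show "\<forall>T\<in>H. \<forall>T'\<in>H. T \<noteq> T' \<longrightarrow> children H T \<inter> children H T' = {}"
    proof (intro ballI impI)
      fix T T' assume TT: "T \<in> H" "T' \<in> H" "T \<noteq> T'"
      then have "compatible T T'" using hierarchyD(5) by blast
      have "False" if U: "U \<in> children H T" "U \<in> children H T'" for U
      proof -
        have "U \<noteq> {}" using U childrenD(1) hierarchyD(2) by blast
        then show False using U TT \<open>compatible T T'\<close>
          unfolding children_def compatible_def by blast
      qed
      then show "children H T \<inter> children H T' = {}" by blast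
    qed
  qed (use hierarchy_finite finite_children in auto)
  moreover have "card (H - {V}) + 1 = card H"
    using hierarchy_finite hierarchyD(3) by (metis Suc_eq_plus1 card_Suc_Diff1)
  ultimately show ?thesis by simp
qed

lemma sum_card_children_nonsingletons:
  defines "N \<equiv> {T\<in>H. \<forall>i. T \<noteq> {i}}"
  shows "(\<Sum>T\<in>N. card (children H T)) + 1 = card H" "card H = card N + card V"
proof -
  let ?S = "(\<lambda>i. {i}) ` V"
  have un: "H = N \<union> ?S" "N \<inter> ?S = {}"
    using hierarchyD(1,4) by (auto simp: N_def)
  have "(\<Sum>T\<in>H. card (children H T)) = (\<Sum>T\<in>N. card (children H T)) + (\<Sum>T\<in>?S. card (children H T))"
    using un hierarchy_finite V by (metis finite_Un sum.union_disjoint)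
  also have "(\<Sum>T\<in>?S. card (children H T)) = 0"
    by (intro sum.neutral) (auto simp: children_singleton)
  finally show "(\<Sum>T\<in>N. card (children H T)) + 1 = card H"
    using sum_card_children by simp
  have "card H = card N + card ?S"
    using un hierarchy_finite V by (metis card_Un_disjoint finite_Un)
  also have "card ?S = card V" by (intro card_image) (auto simp: inj_on_def)
  finally show "card H = card N + card V" .
qed

text \<open>If N nodes are not singletons, each has at least two children, so 2 N is at most
  \<open>card H - 1\<close>, while \<open>card H\<close> is N + \<open>card V\<close>. Binary trees
  attain equality.\<close>

lemma hierarchy_card_le: "card H + 1 \<le> 2 * card V"
proof -
  let ?N = "{T\<in>H. \<forall>i. T \<noteq> {i}}"
  have "card ?N * 2 \<le> (\<Sum>T\<in>?N. card (children H T))"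
    using two_le_card_children by (intro sum_bounded_below[where K = "2::nat", simplified]) auto
  then show ?thesis using sum_card_children_nonsingletons by linarith
qed

lemma hierarchy_card_eq:
  assumes "\<And>T. T \<in> H \<Longrightarrow> card (children H T) \<le> 2"
  shows "card H + 1 = 2 * card V"
proof -
  let ?N = "{T\<in>H. \<forall>i. T \<noteq> {i}}"
  have "(\<Sum>T\<in>?N. card (children H T)) \<le> card ?N * 2"
    using assms by (intro sum_bounded_above[where K = "2::nat", simplified]) auto
  then show ?thesis using sum_card_children_nonsingletons hierarchy_card_le by linarith
qed

end

lemma hierarchy_subset: "hierarchy V (H \<union> G) \<Longrightarrow> hierarchy V H \<Longrightarrow> G' \<subseteq> G \<Longrightarrow> hierarchy V (H \<union> G')"
proof -
  assume H: "hierarchy V (H \<union> G)" "hierarchy V H" "G' \<subseteq> G"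
  then have "H \<union> G' \<subseteq> H \<union> G" by blast
  then have "H \<union> G' \<subseteq> Pow V - {{}}" "\<forall>S\<in>H \<union> G'. \<forall>T\<in>H \<union> G'. compatible S T"
    using H(1) unfolding hierarchy_def by (meson subset_trans subsetD)+
  then show ?thesis using H(2) by (simp add: hierarchy_def)
qed

lemma refinements_mono:
  assumes "G \<in> refinements V H" "hierarchy V H" "G' \<subseteq> G"
  shows "G' \<in> refinements V H"
  using assms hierarchy_subset[of V H G G'] by (auto simp: refinements_def)

lemma finite_refinements:
  assumes "finite V" shows "finite (refinements V H)"
proof (rule finite_subset)
  show "refinements V H \<subseteq> Pow (Pow V)" by (auto simp: refinements_def hierarchy_def)
qed (use assms in simp)

lemma refinements_card_le:
  assumes "finite V" "hierarchy V H" "G \<in> refinements V H"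
  shows "finite G" "card H + card G + 1 \<le> 2 * card V"
proof -
  have H: "hierarchy V (H \<union> G)" "H \<inter> G = {}" using assms by (auto simp: refinements_def)
  show "finite G" using hierarchy_finite[OF assms(1) H(1)] by simp
  then have "card (H \<union> G) = card H + card G"
    using hierarchy_finite[OF assms(1,2)] H by (simp add: card_Un_disjoint)
  then show "card H + card G + 1 \<le> 2 * card V"
    using hierarchy_card_le[OF assms(1) H(1)] by simp
qed

text \<open>A set strictly between \<open>a\<close> and \<open>S\<close> meets \<open>S - a\<close>
  without containing it or lying in it; this is the only obstruction.\<close>

lemma compatible_Diff:
  assumes "compatible U S" "compatible U a" "a \<subseteq> S" "\<not> (a \<subset> U \<and> U \<subset> S)"
  shows "compatible U (S - a)"
proof -
  consider "U \<inter> S = {}" | "S \<subseteq> U" | "U \<subseteq> S" "U \<subseteq> a" | "U \<subseteq> S" "U \<inter> a = {}"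
    using assms unfolding compatible_def by blast
  then show ?thesis by cases (auto simp: compatible_def)
qed

lemma hierarchy_insert:
  assumes "hierarchy V H" "S \<subseteq> V" "S \<noteq> {}" "\<And>U. U \<in> H \<Longrightarrow> compatible U S"
  shows "hierarchy V (insert S H)"
proof -
  have "\<And>U. U \<in> H \<Longrightarrow> compatible S U" using assms(4) by (rule compatible_sym)
  moreover have "compatible S S" by (simp add: compatible_def)
  ultimately show ?thesis using assms unfolding hierarchy_def by simp
qed

text \<open>When \<open>a\<close> is a child of \<open>T\<close>, these are the unions of at least
  two, but not all, children of \<open>T\<close>, one of them being \<open>a\<close>.\<close>

definition intermediates :: "'a set \<Rightarrow> 'a set set \<Rightarrow> 'a set \<Rightarrow> 'a set \<Rightarrow> 'a set set" where
  "intermediates V H a T = {S. a \<subset> S \<and> S \<subset> T \<and> S \<notin> H \<and> hierarchy V (insert S H)}"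

section \<open>Deleting the sets between a child and its parent\<close>

context
  fixes V :: "'a set" and H :: "'a set set" and T a :: "'a set"
  assumes V: "finite V" and H: "hierarchy V H" and T: "T \<in> H"
    and a: "a \<in> children H T" and three: "3 \<le> card (children H T)"
begin

lemmas hierarchy_facts = hierarchyD[OF V H]

lemma child_facts: "a \<in> H" "a \<subset> T" "a \<noteq> {}" "W \<in> H \<Longrightarrow> a \<subset> W \<Longrightarrow> \<not> W \<subset> T"
  using childrenD[OF a] hierarchy_facts(2) by auto

lemma third_child:
  obtains c where "c \<in> children H T" "c \<noteq> a" "c \<noteq> b"
proof -
  have "\<not> children H T \<subseteq> {a, b}"
  proof
    assume "children H T \<subseteq> {a, b}"
    then have "card (children H T) \<le> card {a, b}" by (intro card_mono) auto
    also have "\<dots> \<le> 2" by (simp add: card_insert_if)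
    finally show False using three by simp
  qed
  then show thesis using that by blast
qed

text \<open>Besides \<open>a\<close> there are two further children; either would lie strictly
  inside \<open>T - a\<close>, which would then separate it from \<open>T\<close>.\<close>

lemma rest_notin: "T - a \<notin> H"
proof
  assume X: "T - a \<in> H"
  obtain b where b: "b \<in> children H T" "b \<noteq> a" by (rule third_child)
  obtain c where c: "c \<in> children H T" "c \<noteq> a" "c \<noteq> b" by (rule third_child)
  have dis: "a \<inter> b = {}" "a \<inter> c = {}" "b \<inter> c = {}"
    using children_disjoint[OF V H] a b c by blast+
  have "c \<noteq> {}" using c childrenD(1) hierarchy_facts(2) by metis
  then have "b \<subset> T - a" using childrenD(2)[OF b(1)] childrenD(2)[OF c(1)] dis by blast
  moreover have "T - a \<subset> T" using child_facts by blast
  ultimately show False using childrenD(3)[OF b(1) X] by blast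
qed

text \<open>The third child makes \<open>a \<union> b\<close> smaller than \<open>T\<close>. A node
  meeting the union lies in \<open>a\<close> or in \<open>b\<close>, or properly contains one of
  them and then, these being children, contains \<open>T\<close>.\<close>

lemma pair_intermediate:
  assumes b: "b \<in> children H T" "b \<noteq> a"
  shows "a \<union> b \<in> intermediates V H a T" "a \<union> b - a \<in> H"
proof -
  have sibling_facts: "b \<in> H" "b \<subset> T" "b \<noteq> {}" "\<And>W. W \<in> H \<Longrightarrow> b \<subset> W \<Longrightarrow> \<not> W \<subset> T"
    using childrenD[OF b(1)] hierarchy_facts(2) by auto
  have ab: "a \<inter> b = {}" using children_disjoint[OF V H a b(1)] b by blast
  obtain c where c: "c \<in> children H T" "c \<noteq> a" "c \<noteq> b" by (rule third_child)
  have cc: "c \<noteq> {}" "c \<subset> T" using c childrenD[OF c(1)] hierarchy_facts(2) by auto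
  have "a \<inter> c = {}" "b \<inter> c = {}"
    using children_disjoint[OF V H] a b c by blast+
  then have sub: "a \<subset> a \<union> b" "a \<union> b \<subset> T" using ab sibling_facts(2,3) child_facts(2) cc by blast+
  have nin: "a \<union> b \<notin> H" using child_facts(4) sub by blast
  have "compatible U (a \<union> b)" if U: "U \<in> H" for U
  proof -
    have comp: "compatible U a" "compatible U b" "compatible U T"
      using hierarchy_facts(5) U child_facts(1) sibling_facts(1) T by blast+
    have "T \<subseteq> U" if "a \<subset> U \<or> b \<subset> U"
      using comp(3) that child_facts(2,3) child_facts(4)[OF U] sibling_facts(2,3) sibling_facts(4)[OF U] unfolding compatible_def by blast
    then have "T \<subseteq> U \<or> U \<subseteq> a \<or> U \<subseteq> b \<or> (U \<inter> a = {} \<and> U \<inter> b = {})"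
      using comp(1,2) unfolding compatible_def by blast
    then show ?thesis using sub unfolding compatible_def by blast
  qed
  then have "hierarchy V (insert (a \<union> b) H)"
    using hierarchy_facts(1)[OF T] sub child_facts(3) by (intro hierarchy_insert[OF H]) blast+
  then show "a \<union> b \<in> intermediates V H a T"
    using sub nin by (simp add: intermediates_def)
  have "a \<union> b - a = b" using ab by blast
  then show "a \<union> b - a \<in> H" using sibling_facts by simp
qed

text \<open>A node strictly between \<open>S - a\<close> and \<open>T\<close> would properly contain
  \<open>a\<close>, contrary to \<open>a\<close> being a child; so \<open>S - a\<close> is itself a
  child of \<open>T\<close>.\<close>

lemma critical_intermediates:
  "{S \<in> intermediates V H a T. S - a \<in> H} = (\<union>) a ` (children H T - {a})"
proof
  show "(\<union>) a ` (children H T - {a}) \<subseteq> {S \<in> intermediates V H a T. S - a \<in> H}"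
    using pair_intermediate by blast
  show "{S \<in> intermediates V H a T. S - a \<in> H} \<subseteq> (\<union>) a ` (children H T - {a})"
  proof
    fix S assume "S \<in> {S \<in> intermediates V H a T. S - a \<in> H}"
    then have S: "a \<subset> S" "S \<subset> T" "hierarchy V (insert S H)" "S - a \<in> H"
      by (auto simp: intermediates_def)
    have "\<not> (S - a \<subset> W \<and> W \<subset> T)" if W: "W \<in> H" for W
    proof
      assume A: "S - a \<subset> W \<and> W \<subset> T"
      have "compatible W S" "compatible W a"
        using hierarchyD(5)[OF V S(3), of W S] hierarchy_facts(5) W child_facts(1) by blast+
      then have "a \<subset> W" using A S(1) child_facts(3) unfolding compatible_def by blast
      then show False using child_facts(4) W A by blast
    qed
    then have "S - a \<in> children H T" using S unfolding children_def by blast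
    moreover have "S - a \<noteq> a" "S = a \<union> (S - a)" using child_facts(3) S by blast+
    ultimately show "S \<in> (\<union>) a ` (children H T - {a})" by blast
  qed
qed

lemma card_critical_intermediates:
  "card {S \<in> intermediates V H a T. S - a \<in> H} = card (children H T) - 1"
proof -
  have "inj_on ((\<union>) a) (children H T - {a})"
  proof (rule inj_onI)
    fix b c assume b: "b \<in> children H T - {a}" and c: "c \<in> children H T - {a}" and "a \<union> b = a \<union> c"
    moreover have "a \<inter> b = {}" "a \<inter> c = {}"
      using b c children_disjoint[OF V H a] by blast+
    ultimately show "b = c" by blast
  qed
  then show ?thesis
    unfolding critical_intermediates using a finite_children[OF V H] by (simp add: card_image)
qed

text \<open>This serves both kinds of cone: \<open>S = T\<close> once no intermediate set is left,
  and \<open>S\<close> the vertex under deletion, a member of \<open>G\<close> that is minimal among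
  the remaining intermediate sets.\<close>

lemma insert_apex_in_refinements:
  assumes S: "a \<subset> S" "S \<subseteq> T" "S - a \<notin> H" and G: "G \<in> refinements V H"
    and SG: "S \<in> H \<union> G" and no: "\<And>U. U \<in> G \<Longrightarrow> U \<in> intermediates V H a T \<Longrightarrow> \<not> U \<subset> S"
  shows "insert (S - a) G \<in> refinements V H"
proof -
  have HG: "hierarchy V (H \<union> G)" "H \<inter> G = {}" using G by (auto simp: refinements_def)
  have "compatible U (S - a)" if U: "U \<in> H \<union> G" for U
  proof (rule compatible_Diff)
    show "compatible U S" "compatible U a" using hierarchyD(5)[OF V HG(1)] U SG child_facts(1) by blast+
    show "\<not> (a \<subset> U \<and> U \<subset> S)"
    proof
      assume A: "a \<subset> U \<and> U \<subset> S"
      then have "U \<in> G" using U child_facts(4)[of U] S by blast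
      moreover have "hierarchy V (insert U H)"
        using hierarchy_subset[OF HG(1) H, of "{U}"] \<open>U \<in> G\<close> by simp
      ultimately have "U \<in> intermediates V H a T"
        using A S HG(2) unfolding intermediates_def by blast
      then show False using no \<open>U \<in> G\<close> A by blast
    qed
  qed (use S in blast)
  then have "hierarchy V (insert (S - a) (H \<union> G))"
    using S hierarchy_facts(1)[OF T] by (intro hierarchy_insert[OF HG(1)]) blast+
  then show ?thesis using HG(2) S(3) by (simp add: refinements_def)
qed

text \<open>\<open>D\<close> holds the intermediate sets still present: all of them give the full
  link, none of them the final cone.\<close>

definition undeleted :: "'a set set \<Rightarrow> 'a set set set" where
  "undeleted D = {G \<in> refinements V H. G \<inter> (intermediates V H a T - D) = {}}"

lemma undeleted_mono: "G \<in> undeleted D \<Longrightarrow> G' \<subseteq> G \<Longrightarrow> G' \<in> undeleted D"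
  unfolding undeleted_def using refinements_mono[OF _ H] by blast

lemma Diff_notin_intermediates: "S - a \<notin> intermediates V H a T"
  using child_facts(3) by (auto simp: intermediates_def)

lemma finite_intermediates: "finite (intermediates V H a T)"
proof (rule finite_subset)
  show "intermediates V H a T \<subseteq> Pow V"
    using hierarchy_facts(1)[OF T] by (auto simp: intermediates_def)
qed (use V in simp)

text \<open>\<open>Suc r\<close> is the number of nodes that \<open>H\<close> lacks to reach the
  maximum \<open>2 * card V - 1\<close>.\<close>

lemma card_undeleted:
  assumes "G \<in> undeleted D" "r + card H + 2 = 2 * card V"
  shows "finite G" "card G \<le> Suc r"
  using refinements_card_le[OF V H, of G] assms by (auto simp: undeleted_def)

lemma collapsible_mod_undeleted_empty:
  assumes r: "r + card H + 2 = 2 * card V"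
  shows "collapsible_mod (undeleted {}) 0 (Suc r)"
proof (rule collapsible_mod_cone[of _ "T - a"])
  show "finite (undeleted {})"
    using finite_refinements[OF V, of H] by (simp add: undeleted_def)
  fix G assume G: "G \<in> undeleted {}"
  show "insert (T - a) G \<in> undeleted {} \<and> G - {T - a} \<in> undeleted {}"
  proof
    have "insert (T - a) G \<in> refinements V H"
      using G T child_facts(2) rest_notin by (intro insert_apex_in_refinements) (auto simp: undeleted_def)
    then show "insert (T - a) G \<in> undeleted {}"
      using G Diff_notin_intermediates unfolding undeleted_def by blast
    show "G - {T - a} \<in> undeleted {}" using undeleted_mono[OF G] by blast
  qed
  show "card G \<le> Suc r" using card_undeleted[OF G r] by simp
qed

text \<open>The sets strictly between \<^term>\<open>a\<close> and its parent \<^term>\<open>T\<close> are deleted in increasing order.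
  When \<^term>\<open>S\<close> is deleted, its link is a cone with apex \<^term>\<open>S - a\<close> unless \<^term>\<open>S - a\<close> already belongs
  to the hierarchy, that is, unless \<^term>\<open>S\<close> merges \<^term>\<open>a\<close> with one sibling.\<close>

lemma collapsible_mod_undeleted:
  assumes r: "r + card H + 2 = 2 * card V"
    and pair: "\<And>S. S \<in> intermediates V H a T \<Longrightarrow> S - a \<in> H \<Longrightarrow>
                 collapsible_mod (refinements V (insert S H)) k r"
    and D: "D \<subseteq> intermediates V H a T"
    and up: "\<And>S S'. S \<in> D \<Longrightarrow> S' \<in> intermediates V H a T \<Longrightarrow> S \<subset> S' \<Longrightarrow> S' \<in> D"
  shows "collapsible_mod (undeleted D) (card {S\<in>D. S - a \<in> H} * k) (Suc r)"
proof -
  have "finite D" using D finite_intermediates finite_subset by blast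
  then show ?thesis using D up
  proof (induction D rule: finite_psubset_induct)
    case (psubset D)
    show ?case
    proof (cases "D = {}")
      case True
      then show ?thesis using collapsible_mod_undeleted_empty[OF r] by simp
    next
      case False
      then obtain S where S: "S \<in> D" and Smin: "\<And>U. U \<in> D \<Longrightarrow> \<not> U \<subset> S"
        using finite_has_minimal[OF psubset.hyps(1)] by blast
      define L where "L = {G. S \<notin> G \<and> insert S G \<in> undeleted D}"
      have SI: "S \<in> intermediates V H a T" using S psubset.prems by blast
      then have SD: "a \<subset> S" "S \<subset> T" "S \<notin> H" "hierarchy V (insert S H)"
        by (auto simp: intermediates_def)
      \<comment> \<open>Removing a minimal element keeps \<open>D\<close> closed upwards among the
        intermediate sets.\<close>
      have IH: "collapsible_mod (undeleted (D - {S})) (card {U\<in>D - {S}. U - a \<in> H} * k) (Suc r)"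
      proof (rule psubset.IH)
        show "D - {S} \<subset> D" "D - {S} \<subseteq> intermediates V H a T" using S psubset.prems by blast+
        show "U' \<in> D - {S}" if "U \<in> D - {S}" "U' \<in> intermediates V H a T" "U \<subset> U'" for U U'
          using that psubset.prems(2) Smin by blast
      qed
      have split: "undeleted D = undeleted (D - {S}) \<union> insert S ` L"
      proof
        show "undeleted D \<subseteq> undeleted (D - {S}) \<union> insert S ` L"
        proof
          fix G assume G: "G \<in> undeleted D"
          show "G \<in> undeleted (D - {S}) \<union> insert S ` L"
          proof (cases "S \<in> G")
            case True
            then have "G = insert S (G - {S})" by blast
            then have "G - {S} \<in> L" using G by (simp add: L_def)
            then show ?thesis using \<open>G = insert S (G - {S})\<close> by blast
          next
            case False
            then show ?thesis using G by (auto simp: undeleted_def)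
          qed
        qed
        show "undeleted (D - {S}) \<union> insert S ` L \<subseteq> undeleted D"
          by (auto simp: undeleted_def L_def)
      qed
      have vert: "S \<notin> \<Union>L" "S \<notin> \<Union>(undeleted (D - {S}))"
        using SI by (auto simp: L_def undeleted_def)
      have Lfin: "finite G" if "G \<in> L" for G
      proof -
        have "insert S G \<in> undeleted D" using that by (simp add: L_def)
        then have "finite (insert S G)" by (rule card_undeleted(1)[OF _ r])
        then show ?thesis by simp
      qed
      note step = collapsible_mod_link_deletion[OF _ IH vert Lfin, folded split]
      show ?thesis
      proof (cases "S - a \<in> H")
        case True
        \<comment> \<open>No deleted vertex can occur in these refinements: an intermediate set
          compatible with both \<open>S\<close> and \<open>S - a\<close> contains \<open>S\<close>,
          hence lies in the upward closed \<open>D\<close>.\<close>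
        have "L = refinements V (insert S H)"
        proof
          show "L \<subseteq> refinements V (insert S H)"
            by (auto simp: L_def undeleted_def refinements_def)
          show "refinements V (insert S H) \<subseteq> L"
          proof
            fix G assume G: "G \<in> refinements V (insert S H)"
            then have HG: "hierarchy V (insert S (H \<union> G))" "S \<notin> G" "H \<inter> G = {}"
              by (auto simp: refinements_def)
            then have "insert S G \<in> refinements V H" using SD by (simp add: refinements_def)
            moreover have "U \<in> D" if U: "U \<in> G" "U \<in> intermediates V H a T" for U
            proof -
              have aU: "a \<subset> U" using U(2) by (simp add: intermediates_def)
              have "U \<noteq> S" using U(1) HG(2) by blast
              have "compatible U S" "compatible U (S - a)"
                using hierarchyD(5)[OF V HG(1)] U(1) True by blast+
              then have "S \<subset> U"
                using aU child_facts(3) SD(1) \<open>U \<noteq> S\<close> unfolding compatible_def by blast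
              then show "U \<in> D" using psubset.prems(2)[OF S U(2)] by blast
            qed
            ultimately show "G \<in> L" using S HG(2) unfolding L_def undeleted_def by blast
          qed
        qed
        then have "collapsible_mod L k r" using pair[OF SI True] by simp
        then have "collapsible_mod (undeleted D) (k + card {U\<in>D - {S}. U - a \<in> H} * k) (Suc r)"
          using step by blast
        moreover have "{U\<in>D. U - a \<in> H} = insert S {U\<in>D - {S}. U - a \<in> H}"
          using S True by blast
        then have "card {U\<in>D. U - a \<in> H} = Suc (card {U\<in>D - {S}. U - a \<in> H})"
          using psubset.hyps(1) by simp
        ultimately show ?thesis by simp
      next
        case False
        have "collapsible_mod L 0 r"
        proof (rule collapsible_mod_cone[of _ "S - a"])
          have "inj_on (insert S) L" using vert(1) unfolding inj_on_def by (metis UnionI insert_ident)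
          moreover have "finite (insert S ` L)"
          proof (rule finite_subset)
            show "insert S ` L \<subseteq> refinements V H" by (auto simp: L_def undeleted_def)
          qed (rule finite_refinements[OF V])
          ultimately show "finite L" using finite_imageD by blast
          fix G assume "G \<in> L"
          then have G: "S \<notin> G" "insert S G \<in> undeleted D" by (auto simp: L_def)
          have "S - a \<noteq> S" using SD(1) child_facts(3) by blast
          have "insert (S - a) (insert S G) \<in> refinements V H"
          proof (rule insert_apex_in_refinements)
            show "a \<subset> S" "S \<subseteq> T" "S - a \<notin> H" "S \<in> H \<union> insert S G" using SD False by auto
            show "insert S G \<in> refinements V H" using G by (simp add: undeleted_def)
            show "\<not> U \<subset> S" if "U \<in> insert S G" "U \<in> intermediates V H a T" for U
            proof -
              have "U \<in> D" using that G(2) unfolding undeleted_def by blast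
              then show ?thesis by (rule Smin)
            qed
          qed
          \<comment> \<open>\<open>S - a\<close> does not contain \<open>a\<close>, so the apex is
            never a deleted vertex.\<close>
          then have "insert (S - a) (insert S G) \<in> undeleted D"
            using G(2) Diff_notin_intermediates unfolding undeleted_def by blast
          then have "insert (S - a) G \<in> L"
            using G(1) \<open>S - a \<noteq> S\<close> by (simp add: L_def insert_commute)
          moreover have "insert S (G - {S - a}) \<in> undeleted D"
            by (rule undeleted_mono[OF G(2)]) blast
          then have "G - {S - a} \<in> L" using G(1) by (simp add: L_def)
          ultimately show "insert (S - a) G \<in> L \<and> G - {S - a} \<in> L" by blast
          have "finite G" using Lfin \<open>G \<in> L\<close> by blast
          then show "card G \<le> r" using card_undeleted(2)[OF G(2) r] G(1) by simp
        qed
        then have "collapsible_mod (undeleted D) (0 + card {U\<in>D - {S}. U - a \<in> H} * k) (Suc r)"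
          using step by blast
        moreover have "{U\<in>D. U - a \<in> H} = {U\<in>D - {S}. U - a \<in> H}"
          using False by blast
        ultimately show ?thesis by simp
      qed
    qed
  qed
qed

lemma collapsible_mod_refinements_step:
  assumes r: "r + card H + 2 = 2 * card V"
    and pair: "\<And>b. b \<in> children H T \<Longrightarrow> b \<noteq> a \<Longrightarrow>
                 collapsible_mod (refinements V (insert (a \<union> b) H)) k r"
  shows "collapsible_mod (refinements V H) ((card (children H T) - 1) * k) (Suc r)"
proof -
  have "collapsible_mod (undeleted (intermediates V H a T))
          (card {S \<in> intermediates V H a T. S - a \<in> H} * k) (Suc r)"
  proof (rule collapsible_mod_undeleted[OF r])
    fix S assume "S \<in> intermediates V H a T" "S - a \<in> H"
    then have "S \<in> (\<union>) a ` (children H T - {a})" using critical_intermediates by blast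
    then show "collapsible_mod (refinements V (insert S H)) k r" using pair by blast
  qed auto
  moreover have "undeleted (intermediates V H a T) = refinements V H" by (simp add: undeleted_def)
  ultimately show ?thesis by (simp add: card_critical_intermediates)
qed

section \<open>Merging a child with one of its siblings\<close>

context
  fixes b
  assumes b: "b \<in> children H T" "b \<noteq> a"
begin

lemma merged_pair_facts: "a \<subset> a \<union> b" "a \<union> b \<subset> T" "a \<union> b \<notin> H" "hierarchy V (insert (a \<union> b) H)"
  using pair_intermediate(1)[OF b] by (auto simp: intermediates_def)

lemma sibling_facts: "b \<in> H" "b \<subset> T" "b \<noteq> {}" "W \<in> H \<Longrightarrow> b \<subset> W \<Longrightarrow> \<not> W \<subset> T"
  using childrenD[OF b(1)] hierarchy_facts(2) by auto

lemma above_pair: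
  assumes "W \<in> H" "a \<union> b \<subset> W" shows "T \<subseteq> W"
proof -
  have "compatible W T" using hierarchy_facts(5) assms T by blast
  then show ?thesis using assms child_facts(2,3) child_facts(4)[of W] unfolding compatible_def by blast
qed

lemma below_pair:
  assumes "W \<in> H" "W \<subset> a \<union> b" shows "W \<subseteq> a \<or> W \<subseteq> b"
proof -
  have "compatible W a" using hierarchy_facts(5) assms child_facts(1) by blast
  moreover have "\<not> a \<subset> W" using child_facts(4) assms merged_pair_facts by blast
  ultimately show ?thesis using assms unfolding compatible_def by blast
qed

lemma children_insert_pair_other:
  assumes "X \<in> H" "X \<noteq> T"
  shows "children (insert (a \<union> b) H) X = children H X"
proof
  have *: "T \<subset> X" if "a \<union> b \<subset> X" using above_pair[OF assms(1) that] assms(2) by blast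
  show "children (insert (a \<union> b) H) X \<subseteq> children H X"
  proof
    fix U assume U: "U \<in> children (insert (a \<union> b) H) X"
    then have "U \<noteq> a \<union> b" using * T merged_pair_facts(2) unfolding children_def by blast
    then show "U \<in> children H X" using U unfolding children_def by blast
  qed
  show "children H X \<subseteq> children (insert (a \<union> b) H) X"
  proof
    fix U assume U: "U \<in> children H X"
    have "\<not> (U \<subset> a \<union> b \<and> a \<union> b \<subset> X)"
      using * childrenD(3)[OF U T] merged_pair_facts(2) by blast
    then show "U \<in> children (insert (a \<union> b) H) X" using U unfolding children_def by blast
  qed
qed

lemma children_insert_pair_parent:
  "children (insert (a \<union> b) H) T = insert (a \<union> b) (children H T - {a, b})"
proof
  show "children (insert (a \<union> b) H) T \<subseteq> insert (a \<union> b) (children H T - {a, b})"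
  proof
    fix U assume U: "U \<in> children (insert (a \<union> b) H) T"
    have "a \<inter> b = {}" using children_disjoint[OF V H a b(1)] b by blast
    then have "b \<subset> a \<union> b" using child_facts(3) by blast
    then have "U \<noteq> a" "U \<noteq> b" using U merged_pair_facts(1,2) unfolding children_def by blast+
    then show "U \<in> insert (a \<union> b) (children H T - {a, b})" using U unfolding children_def by blast
  qed
  show "insert (a \<union> b) (children H T - {a, b}) \<subseteq> children (insert (a \<union> b) H) T"
  proof
    fix U assume "U \<in> insert (a \<union> b) (children H T - {a, b})"
    then consider "U = a \<union> b" | "U \<in> children H T" "U \<noteq> a" "U \<noteq> b" by blast
    then show "U \<in> children (insert (a \<union> b) H) T"
    proof cases
      case 1
      then show ?thesis using above_pair merged_pair_facts(2) unfolding children_def by blast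
    next
      case 2
      have "\<not> U \<subset> a \<union> b"
      proof
        assume "U \<subset> a \<union> b"
        then have "U \<subseteq> a \<or> U \<subseteq> b" using below_pair childrenD(1)[OF 2(1)] by blast
        moreover have "U \<inter> a = {}" "U \<inter> b = {}"
          using children_disjoint[OF V H 2(1)] a b 2 by blast+
        moreover have "U \<noteq> {}" using childrenD(1)[OF 2(1)] hierarchy_facts(2) by blast
        ultimately show False by blast
      qed
      then show ?thesis using 2(1) unfolding children_def by blast
    qed
  qed
qed

lemma children_insert_pair_self: "children (insert (a \<union> b) H) (a \<union> b) = {a, b}"
proof
  have ab: "a \<inter> b = {}" using children_disjoint[OF V H a b(1)] b by blast
  have "\<not> (a \<subset> W \<and> W \<subset> a \<union> b)" "\<not> (b \<subset> W \<and> W \<subset> a \<union> b)" if "W \<in> H" for W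
    using that child_facts(4) sibling_facts(4) merged_pair_facts(2) by blast+
  then show "{a, b} \<subseteq> children (insert (a \<union> b) H) (a \<union> b)"
    using child_facts(1,3) sibling_facts(1,3) ab unfolding children_def by blast
  show "children (insert (a \<union> b) H) (a \<union> b) \<subseteq> {a, b}"
  proof
    fix U assume U: "U \<in> children (insert (a \<union> b) H) (a \<union> b)"
    then have "U \<in> H" "U \<subset> a \<union> b" by (auto simp: children_def)
    then have "U \<subseteq> a \<or> U \<subseteq> b" by (rule below_pair)
    moreover have "\<not> U \<subset> a" "\<not> U \<subset> b"
      using U child_facts(1,3) sibling_facts(1,3) ab unfolding children_def by blast+
    ultimately show "U \<in> {a, b}" by blast
  qed
qed

text \<open>The new node has two children and contributes \<open>fact 1\<close>; \<open>T\<close>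
  loses one child, which costs exactly the factor in front; the other nodes keep their children.
  Hence the product after merging is the same for every sibling.\<close>

lemma prod_fact_children_insert_pair:
  "(card (children H T) - 1) *
     (\<Prod>X\<in>insert (a \<union> b) H. fact (card (children (insert (a \<union> b) H) X) - 1) :: nat)
   = (\<Prod>X\<in>H. fact (card (children H X) - 1))"
proof -
  let ?H = "insert (a \<union> b) H"
  let ?f = "\<lambda>X. fact (card (children H X) - 1) :: nat"
  let ?g = "\<lambda>X. fact (card (children ?H X) - 1) :: nat"
  have finH: "finite H" by (rule hierarchy_finite[OF V H])
  have "card {a, b} = 2" using b(2) by simp
  then have self: "?g (a \<union> b) = 1" by (simp add: children_insert_pair_self)
  have "card (insert (a \<union> b) (children H T - {a, b})) = Suc (card (children H T - {a, b}))"
    using merged_pair_facts(3) finite_children[OF V H] by (intro card_insert_disjoint) (auto simp: children_def)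
  also have "card (children H T - {a, b}) = card (children H T) - 2"
    using a b finite_children[OF V H] \<open>card {a, b} = 2\<close> by (subst card_Diff_subset) auto
  finally have par: "card (children ?H T) = card (children H T) - 1"
    using three by (simp add: children_insert_pair_parent)
  have "?f T = (card (children H T) - 1) * ?g T"
    using three fact_reduce[of "card (children H T) - 1", where 'a = nat] par by simp
  moreover have "(\<Prod>X\<in>H - {T}. ?g X) = (\<Prod>X\<in>H - {T}. ?f X)"
    by (intro prod.cong) (auto simp: children_insert_pair_other)
  moreover have "(\<Prod>X\<in>?H. ?g X) = (\<Prod>X\<in>H. ?g X)"
    using self merged_pair_facts(3) finH by simp
  ultimately show ?thesis
    using prod.remove[OF finH T, of ?f] prod.remove[OF finH T, of ?g] by simp
qed

end

end

text \<open>A maximal hierarchy has \<open>2 * card V - 1\<close> nodes, which gives the size of the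
  top faces. Singletons have no children and contribute \<open>fact (0 - 1) = 1\<close>, by
  truncated subtraction.\<close>

theorem collapsible_mod_refinements:
  assumes V: "finite V" and H: "hierarchy V H"
  shows "collapsible_mod (refinements V H) (\<Prod>T\<in>H. fact (card (children H T) - 1))
           (2 * card V - 1 - card H)"
  using H
proof (induction "2 * card V - card H" arbitrary: H rule: less_induct)
  case less
  note H = less.prems
  note le = hierarchy_card_le[OF V H]
  show ?case
  proof (cases "\<exists>T\<in>H. 3 \<le> card (children H T)")
    case True
    then obtain T where T: "T \<in> H" "3 \<le> card (children H T)" by blast
    then obtain a where a: "a \<in> children H T" by fastforce
    obtain b where b: "b \<in> children H T" "b \<noteq> a" using third_child[OF V H T(1) a T(2)] by blast
    define k where "k b = (\<Prod>X\<in>insert (a \<union> b) H. fact (card (children (insert (a \<union> b) H) X) - 1) :: nat)" for b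
    define r where "r = 2 * card V - 2 - card H"
    have card_pair: "card (insert (a \<union> c) H) = Suc (card H)"
      "hierarchy V (insert (a \<union> c) H)" "card H + 2 \<le> 2 * card V"
      if c: "c \<in> children H T" "c \<noteq> a" for c
    proof -
      note D = merged_pair_facts[OF V H T(1) a T(2) c]
      show "card (insert (a \<union> c) H) = Suc (card H)" using D(3) hierarchy_finite[OF V H] by simp
      then show "card H + 2 \<le> 2 * card V" using hierarchy_card_le[OF V D(4)] by simp
    qed (rule merged_pair_facts[OF V H T(1) a T(2) c])
    have r: "r + card H + 2 = 2 * card V" using card_pair(3)[OF b] by (simp add: r_def)
    have prod: "(card (children H T) - 1) * k c = (\<Prod>X\<in>H. fact (card (children H X) - 1))"
      if "c \<in> children H T" "c \<noteq> a" for c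
      unfolding k_def using prod_fact_children_insert_pair[OF V H T(1) a T(2) that] .
    have "collapsible_mod (refinements V H) ((card (children H T) - 1) * k b) (Suc r)"
    proof (rule collapsible_mod_refinements_step[OF V H T(1) a T(2) r])
      fix c assume c: "c \<in> children H T" "c \<noteq> a"
      have "(card (children H T) - 1) * k c = (card (children H T) - 1) * k b"
        using prod[OF c] prod[OF b] by simp
      \<comment> \<open>The common factor is at least 2 and cancels; one and the same
        \<open>k\<close> is required for all siblings.\<close>
      then have "k c = k b" using T(2) by simp
      moreover have "collapsible_mod (refinements V (insert (a \<union> c) H)) (k c)
          (2 * card V - 1 - card (insert (a \<union> c) H))"
        unfolding k_def using card_pair[OF c] by (intro less.hyps) auto
      moreover have "2 * card V - 1 - card (insert (a \<union> c) H) = r"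
        using card_pair(1)[OF c] by (simp add: r_def)
      ultimately show "collapsible_mod (refinements V (insert (a \<union> c) H)) (k b) r" by simp
    qed
    moreover have "Suc r = 2 * card V - 1 - card H" using r by simp
    ultimately show ?thesis using prod[OF b] by simp
  next
    case False
    then have two: "card (children H T) \<le> 2" if "T \<in> H" for T using that by force
    then have eq: "card H + 1 = 2 * card V" using hierarchy_card_eq[OF V H] by blast
    have "G = {}" if "G \<in> refinements V H" for G
    proof -
      have "card G = 0" using refinements_card_le(2)[OF V H that] eq by linarith
      then show ?thesis using refinements_card_le(1)[OF V H that] by simp
    qed
    moreover have "{} \<in> refinements V H" using H by (simp add: refinements_def)
    ultimately have "refinements V H = {{}}" by blast
    moreover have "(\<Prod>T\<in>H. fact (card (children H T) - 1) :: nat) = 1"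
    proof (intro prod.neutral ballI)
      fix T assume "T \<in> H"
      then have "card (children H T) - 1 = 0 \<or> card (children H T) - 1 = 1" using two[of T] by linarith
      then show "fact (card (children H T) - 1) = (1::nat)" by auto
    qed
    ultimately show ?thesis using eq collapsible_mod_singleton_empty by simp
  qed
qed

section \<open>Realizations of collapsible complexes\<close>

definition simplicial_complex :: "'v set set \<Rightarrow> bool" where
  "simplicial_complex K \<longleftrightarrow> finite (\<Union>K) \<and> (\<forall>\<sigma>\<in>K. \<forall>\<tau>\<subseteq>\<sigma>. \<tau> \<in> K)"

lemma simplicial_complexD:
  assumes "simplicial_complex K"
  shows "finite (\<Union>K)" "finite K" "\<sigma> \<in> K \<Longrightarrow> finite \<sigma>" "\<sigma> \<in> K \<Longrightarrow> \<tau> \<subseteq> \<sigma> \<Longrightarrow> \<tau> \<in> K"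
  using assms by (auto simp: simplicial_complex_def intro: finite_UnionD finite_subset)

text \<open>Summing over the fixed finite set \<open>\<Union>K\<close> instead of the varying
  support makes the normalisation a continuous condition.\<close>

lemma realization_iff:
  assumes K: "simplicial_complex K"
  shows "x \<in> topspace (realization K) \<longleftrightarrow> {v. x v \<noteq> 0} \<in> K \<and> (\<forall>v. 0 \<le> x v) \<and> sum x (\<Union>K) = 1"
proof -
  have "sum x {v. x v \<noteq> 0} = sum x (\<Union>K)" if "{v. x v \<noteq> 0} \<in> K"
    using that simplicial_complexD(1)[OF K] by (intro sum.mono_neutral_left) auto
  then show ?thesis by (auto simp: realization_def)
qed

lemma sum_eq_1_superset:
  assumes K: "simplicial_complex K" and x: "x \<in> topspace (realization K)"
    and S: "finite S" "{v. x v \<noteq> 0} \<subseteq> S"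
  shows "sum x S = 1"
proof -
  have "sum x {v. x v \<noteq> 0} = sum x S" using S by (intro sum.mono_neutral_left) auto
  then show ?thesis using x by (auto simp: realization_def)
qed

lemma continuous_map_realization:
  "continuous_map X (realization K) g \<longleftrightarrow>
     (\<forall>v. continuous_map X euclideanreal (\<lambda>x. g x v)) \<and> (\<forall>x\<in>topspace X. g x \<in> topspace (realization K))"
  unfolding realization_def
  by (simp add: continuous_map_in_subtopology continuous_map_componentwise_UNIV Pi_iff)

lemma continuous_map_coordinate: "continuous_map (realization K) euclideanreal (\<lambda>x. x v)"
  using continuous_map_id[of "realization K"] unfolding continuous_map_realization by simp

lemma continuous_map_Min:
  fixes f :: "'a \<Rightarrow> 'i \<Rightarrow> real"
  assumes "finite S" "S \<noteq> {}" "\<And>i. i \<in> S \<Longrightarrow> continuous_map X euclideanreal (\<lambda>x. f x i)"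
  shows "continuous_map X euclideanreal (\<lambda>x. Min (f x ` S))"
  using assms
proof (induction S rule: finite_ne_induct)
  case (insert i S)
  then have "continuous_map X euclideanreal (\<lambda>x. min (f x i) (Min (f x ` S)))"
    by (intro continuous_map_real_min) auto
  moreover have "Min (f x ` insert i S) = min (f x i) (Min (f x ` S))" for x
    using insert by simp
  ultimately show ?case by simp
qed simp

text \<open>The realization is closed in a product of unit intervals. The support condition is
  closed as a finite union, over the faces, of the condition to vanish off the face.\<close>

lemma compact_space_realization:
  assumes K: "simplicial_complex K"
  shows "compact_space (realization K)"
proof -
  let ?P = "powertop_real (UNIV :: 'a set)"
  let ?F = "{x. {v. x v \<noteq> 0} \<in> K \<and> (\<forall>v. 0 \<le> x v) \<and> sum x (\<Union>K) = (1::real)}"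
  have cl: "closedin ?P {x. P x}" if "P = (\<lambda>x. f x \<in> S)" "closed S" "continuous_map ?P euclideanreal f"
    for P and f :: "('a \<Rightarrow> real) \<Rightarrow> real" and S
    using closedin_continuous_map_preimage[OF that(3), of S] that(1,2) by simp
  have proj: "continuous_map ?P euclideanreal (\<lambda>x. x v)" for v
    by (rule continuous_map_product_projection) simp
  have face: "closedin ?P {x. {v. x v \<noteq> 0} \<in> K}"
  proof -
    have "closedin ?P {x. v \<in> \<sigma> \<or> x v = 0}" for v \<sigma>
    proof (cases "v \<in> \<sigma>")
      case True
      then show ?thesis using closedin_topspace[of ?P] by simp
    next
      case False
      then show ?thesis using cl[of _ "\<lambda>x. x v" "{0}"] proj by simp
    qed
    then have "closedin ?P (\<Union>\<sigma>\<in>K. \<Inter>v. {x. v \<in> \<sigma> \<or> x v = 0})"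
      using simplicial_complexD(2)[OF K] by (intro closedin_Union) auto
    moreover have "(\<Union>\<sigma>\<in>K. \<Inter>v. {x. v \<in> \<sigma> \<or> x v = (0::real)}) = {x. {v. x v \<noteq> 0} \<in> K}" (is "?l = ?r")
    proof
      show "?l \<subseteq> ?r"
      proof
        fix x assume "x \<in> ?l"
        then obtain \<sigma> where s: "\<sigma> \<in> K" "\<forall>v. v \<in> \<sigma> \<or> x v = 0" by blast
        then have "{v. x v \<noteq> 0} \<subseteq> \<sigma>" by blast
        then show "x \<in> ?r" using simplicial_complexD(4)[OF K s(1)] by simp
      qed
      show "?r \<subseteq> ?l" by blast
    qed
    ultimately show ?thesis by simp
  qed
  have "closedin ?P (\<Inter>v. {x. 0 \<le> x v})"
  proof (rule closedin_INT)
    show "closedin ?P {x. 0 \<le> x v}" for v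
      by (rule cl[of _ "\<lambda>x. x v" "{0..}"]) (auto simp: proj)
  qed auto
  moreover have "closedin ?P {x. sum x (\<Union>K) = 1}"
  proof (rule cl[of _ "\<lambda>x. sum x (\<Union>K)" "{1}"])
    show "continuous_map ?P euclideanreal (\<lambda>x. sum x (\<Union>K))"
      using simplicial_complexD(1)[OF K] by (intro continuous_map_sum proj)
  qed auto
  ultimately have "closedin ?P ({x. {v. x v \<noteq> 0} \<in> K} \<inter> ((\<Inter>v. {x. 0 \<le> x v}) \<inter> {x. sum x (\<Union>K) = 1}))"
    using face by (intro closedin_Int)
  moreover have "{x. {v. x v \<noteq> 0} \<in> K} \<inter> ((\<Inter>v. {x. 0 \<le> x v}) \<inter> {x. sum x (\<Union>K) = (1::real)}) = ?F"
    by blast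
  ultimately have closed: "closedin ?P ?F" by simp
  have "compactin ?P (PiE UNIV (\<lambda>_. {0..1::real}))"
    by (simp add: compactin_PiE)
  moreover have "?F \<subseteq> PiE UNIV (\<lambda>_. {0..1::real})"
  proof
    fix x assume x: "x \<in> ?F"
    have "x v \<le> 1" for v
    proof (cases "v \<in> \<Union>K")
      case True
      then have "x v \<le> sum x (\<Union>K)"
        using x simplicial_complexD(1)[OF K] by (intro member_le_sum) auto
      then show ?thesis using x by simp
    next
      case False
      then have "x v = 0" using x by blast
      then show ?thesis by simp
    qed
    then show "x \<in> PiE UNIV (\<lambda>_. {0..1::real})" using x by auto
  qed
  ultimately have "compactin ?P ?F" using closed closed_compactin by blast
  moreover have "topspace (realization K) = ?F" using realization_iff[OF K] by blast
  then have "realization K = subtopology ?P ?F"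
    unfolding realization_def by simp
  ultimately show ?thesis by (simp add: compact_space_subtopology)
qed

text \<open>The free face \<^term>\<open>\<sigma>\<close> is pushed towards the opposite vertex \<^term>\<open>v\<close>: the smallest
  barycentric coordinate on \<^term>\<open>\<sigma>\<close> is subtracted from every coordinate in \<^term>\<open>\<sigma>\<close>, and the lost
  mass is moved to \<^term>\<open>v\<close>.\<close>

lemma elementary_collapse_homotopy_equivalent:
  assumes K: "simplicial_complex K"
    and \<sigma>: "\<sigma> \<in> K" "\<sigma> \<noteq> {}" "v \<notin> \<sigma>" "insert v \<sigma> \<in> K"
    and free: "\<And>\<rho>. \<rho> \<in> K \<Longrightarrow> \<sigma> \<subseteq> \<rho> \<Longrightarrow> \<rho> = \<sigma> \<or> \<rho> = insert v \<sigma>"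
    and K': "K' = K - {\<sigma>, insert v \<sigma>}"
  shows "simplicial_complex K'" "realization K homotopy_equivalent_space realization K'"
proof -
  note KD = simplicial_complexD[OF K]
  show cK': "simplicial_complex K'"
    unfolding simplicial_complex_def
  proof (intro conjI ballI allI impI)
    show "finite (\<Union>K')" using KD(1) by (rule finite_subset[rotated]) (auto simp: K')
    fix \<rho> \<tau> assume *: "\<rho> \<in> K'" "\<tau> \<subseteq> \<rho>"
    then have "\<not> \<sigma> \<subseteq> \<rho>" using free K' by blast
    then have "\<tau> \<noteq> \<sigma>" "\<tau> \<noteq> insert v \<sigma>" using * by blast+
    then show "\<tau> \<in> K'" using * KD(4) K' by blast
  qed
  define m where "m x = Min (x ` \<sigma>)" for x :: "'a \<Rightarrow> real"
  \<comment> \<open>All \<open>card \<sigma>\<close> coordinates lose \<open>t * m x\<close>, whence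
    the factor in the mass given to \<open>v\<close>.\<close>
  define h where "h = (\<lambda>(t::real, x :: 'a \<Rightarrow> real). \<lambda>i. x i - t * (if i \<in> \<sigma> then m x else 0)
                       + t * (if i = v then card \<sigma> * m x else 0))"
  have fin: "finite \<sigma>" using KD \<sigma> by blast
  have m_le: "m x \<le> x i" if "i \<in> \<sigma>" for x i using that fin by (simp add: m_def)
  have m_attained: "\<exists>i\<in>\<sigma>. x i = m x" for x
  proof -
    have "m x \<in> x ` \<sigma>" unfolding m_def using fin \<sigma> by (intro Min_in) auto
    then show ?thesis by force
  qed
  have m_nonneg: "0 \<le> m x" if "x \<in> topspace (realization K)" for x
    using that m_attained[of x] by (metis realization_iff[OF K])
  have h_fixed: "h (t, x) = x" if "m x = 0" for t x using that by (auto simp: h_def intro!: ext)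
  have h_in: "h (t, x) \<in> topspace (realization K)"
    if t: "0 \<le> t" "t \<le> 1" and x: "x \<in> topspace (realization K)" for t x
  proof (cases "m x = 0")
    case True
    then show ?thesis using x h_fixed by simp
  next
    case False
    then have m: "0 < m x" using m_nonneg[OF x] by simp
    note xD = x[unfolded realization_iff[OF K]]
    have "i \<in> {i. x i \<noteq> 0}" if "i \<in> \<sigma>" for i using m_le[OF that, of x] m by simp
    \<comment> \<open>A positive minimum puts \<open>\<sigma>\<close> inside the support, and
      freeness leaves two possible supports.\<close>
    then have "{i. x i \<noteq> 0} = \<sigma> \<or> {i. x i \<noteq> 0} = insert v \<sigma>" using free xD by blast
    then have "x i = 0" if "i \<notin> insert v \<sigma>" for i using that by blast
    then have "h (t, x) i = 0" if "i \<notin> insert v \<sigma>" for i using that by (simp add: h_def)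
    then have "{i. h (t, x) i \<noteq> 0} \<subseteq> insert v \<sigma>" by blast
    then have "{i. h (t, x) i \<noteq> 0} \<in> K" using KD(4)[OF \<sigma>(4)] by blast
    moreover have "0 \<le> h (t, x) i" for i
    proof -
      have "t * m x \<le> x i" if "i \<in> \<sigma>"
        using mult_right_mono[OF t(2), of "m x"] m m_le[OF that, of x] by linarith
      then show ?thesis using xD t m by (auto simp: h_def)
    qed
    moreover have "sum (h (t, x)) (\<Union>K) = 1"
    proof -
      have "(\<Sum>i\<in>\<Union>K. if i \<in> \<sigma> then m x else 0) = (\<Sum>i\<in>\<sigma>. m x)"
        using KD(1) \<sigma>(1) by (intro sum.mono_neutral_cong_right) auto
      moreover have "(\<Sum>i\<in>\<Union>K. if i = v then card \<sigma> * m x else 0) = card \<sigma> * m x"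
        using KD(1) \<sigma>(4) by (subst sum.delta) auto
      ultimately show ?thesis
        using xD by (simp add: h_def sum.distrib sum_subtractf flip: sum_distrib_left)
    qed
    ultimately show ?thesis by (simp add: realization_iff[OF K])
  qed
  have UnK: "sum x (\<Union>K') = 1" if "x \<in> topspace (realization K)" "{v. x v \<noteq> 0} \<in> K'" for x
    using that(2) simplicial_complexD(1)[OF cK'] by (intro sum_eq_1_superset[OF K that(1)]) auto
  have h1_in: "h (1, x) \<in> topspace (realization K')" if x: "x \<in> topspace (realization K)" for x
  proof -
    obtain i where i: "i \<in> \<sigma>" "x i = m x" using m_attained by blast
    then have "h (1, x) i = 0" using \<sigma>(3) by (auto simp: h_def)
    then have "{j. h (1, x) j \<noteq> 0} \<noteq> \<sigma>" "{j. h (1, x) j \<noteq> 0} \<noteq> insert v \<sigma>" using i by blast+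
    moreover have h: "h (1, x) \<in> topspace (realization K)" using h_in[of 1] x by simp
    ultimately have "{j. h (1, x) j \<noteq> 0} \<in> K'" by (simp add: realization_iff[OF K] K')
    then show ?thesis using h UnK by (simp add: realization_iff[OF K] realization_iff[OF cK'])
  qed
  \<comment> \<open>On the smaller complex some coordinate of \<open>\<sigma>\<close> is 0, so the
    homotopy is stationary there.\<close>
  have sub: "x \<in> topspace (realization K) \<and> m x = 0" if "x \<in> topspace (realization K')" for x
  proof -
    have x: "{i. x i \<noteq> 0} \<in> K'" "\<forall>v. 0 \<le> x v" using that by (auto simp: realization_iff[OF cK'])
    then have xK: "x \<in> topspace (realization K)"
      using that by (auto simp: realization_def K')
    have "\<not> \<sigma> \<subseteq> {i. x i \<noteq> 0}" using x(1) free K' by blast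
    then obtain i where "i \<in> \<sigma>" "x i = 0" by blast
    then have "m x \<le> 0" using m_le[of i x] by simp
    then show ?thesis using m_nonneg[OF xK] xK by simp
  qed
  let ?I = "top_of_set {0..1::real}"
  have cm: "continuous_map (prod_topology ?I (realization K)) euclideanreal (\<lambda>z. m (snd z))"
    unfolding m_def using fin \<sigma>
    by (intro continuous_map_Min continuous_map_compose[OF continuous_map_snd continuous_map_coordinate, unfolded o_def]) auto
  have ct: "continuous_map (prod_topology ?I (realization K)) euclideanreal fst"
    using continuous_map_fst[of ?I] continuous_map_into_fulltopology by blast
  have cx: "continuous_map (prod_topology ?I (realization K)) euclideanreal (\<lambda>z. snd z i)" for i
    by (rule continuous_map_compose[OF continuous_map_snd continuous_map_coordinate, unfolded o_def])
  have ch: "continuous_map (prod_topology ?I (realization K)) euclideanreal (\<lambda>z. h z i)" for i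
    unfolding h_def case_prod_unfold by (intro continuous_intros cm ct cx)
  have hom: "homotopic_with (\<lambda>x. True) (realization K) (realization K) id (\<lambda>x. h (1, x))"
    unfolding homotopic_with_def
  proof (intro exI conjI)
    show "continuous_map (prod_topology ?I (realization K)) (realization K) h"
      using ch h_in by (auto simp: continuous_map_realization)
  qed (auto simp: h_def)
  have "continuous_map (realization K) euclideanreal (\<lambda>x. h (1, x) i)" for i
    using continuous_map_compose[OF _ ch, of "realization K" "\<lambda>x. (1, x)", unfolded o_def]
    by (simp add: continuous_map_pairwise o_def)
  then have "retraction_maps (realization K) (realization K') (\<lambda>x. h (1, x)) id"
    unfolding retraction_maps_def
    using h1_in sub h_fixed by (auto simp: continuous_map_realization continuous_map_coordinate)
  then show "realization K homotopy_equivalent_space realization K'"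
    by (rule deformation_retract_imp_homotopy_equivalent_space[OF homotopic_with_symD[OF hom]])
qed

text \<open>The collapse of the empty face with the last vertex has no geometric counterpart: there
  the realization is a point. Every earlier collapse is a homotopy equivalence.\<close>

lemma collapsible_imp_contractible:
  assumes "collapsible K" "simplicial_complex K" "K \<noteq> {}"
  shows "contractible_space (realization K) \<and> topspace (realization K) \<noteq> {}"
  using assms
proof (induction K rule: collapsible.induct)
  case (step \<sigma> K v)
  note KD = simplicial_complexD[OF step.prems(1)]
  show ?case
  proof (cases "\<sigma> = {}")
    case True
    then have K: "K = {{}, {v}}" using step.hyps by blast
    have "x \<in> topspace (realization K) \<longleftrightarrow> x = (\<lambda>i. if i = v then 1 else 0)" for x
      unfolding realization_iff[OF step.prems(1)]
    proof
      assume x: "{i. x i \<noteq> 0} \<in> K \<and> (\<forall>v. 0 \<le> x v) \<and> sum x (\<Union> K) = 1"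
      then have "x v = 1" "\<And>i. i \<noteq> v \<Longrightarrow> x i = 0" by (auto simp: K)
      then show "x = (\<lambda>i. if i = v then 1 else 0)" by auto
    qed (auto simp: K)
    then have "topspace (realization K) = {\<lambda>i. if i = v then 1 else 0}" by blast
    then show ?thesis by (simp add: contractible_space_subset_singleton)
  next
    case False
    let ?K' = "K - {\<sigma>, insert v \<sigma>}"
    note E = elementary_collapse_homotopy_equivalent[OF step.prems(1) step.hyps(1) False step.hyps(2-4) refl]
    have "{} \<in> ?K'" using KD(4)[OF step.hyps(1)] False by blast
    then have IH: "contractible_space (realization ?K')" "topspace (realization ?K') \<noteq> {}"
      using step.IH E(1) by blast+
    moreover have "topspace (realization ?K') \<subseteq> topspace (realization K)"
      by (auto simp: realization_def)
    ultimately show ?thesis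
      using homotopy_equivalent_space_contractibility[OF E(2)] by blast
  qed
qed simp

section \<open>Contracting a subcomplex\<close>

text \<open>If a homotopy of \<^term>\<open>X\<close> contracts \<^term>\<open>A\<close> within \<^term>\<open>A\<close>, then collapsing \<^term>\<open>A\<close> to a point is a
  homotopy equivalence; \<^term>\<open>W\<close> plays the role of the quotient \<open>X / A\<close>.\<close>

lemma quotient_homotopy_equivalent:
  assumes X: "compact_space X" and W: "Hausdorff_space W" and q: "continuous_map X W q"
    and surj: "q ` topspace X = topspace W" and A: "A \<subseteq> topspace X"
    and fib: "\<And>x y. x \<in> topspace X \<Longrightarrow> y \<in> topspace X \<Longrightarrow> q x = q y \<Longrightarrow> x = y \<or> x \<in> A \<and> y \<in> A"
    and qA: "\<And>x y. x \<in> A \<Longrightarrow> y \<in> A \<Longrightarrow> q x = q y"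
    and hom: "homotopic_with (\<lambda>f. f ` A \<subseteq> A) X X id p"
    and pA: "\<And>x y. x \<in> A \<Longrightarrow> y \<in> A \<Longrightarrow> p x = p y"
  shows "X homotopy_equivalent_space W"
proof -
  let ?I = "top_of_set {0..1::real}"
  \<comment> \<open>An arbitrary section, in general not continuous; it is used only in composites
    that do not see the choice made within \<open>A\<close>.\<close>
  define s where "s = inv_into (topspace X) q"
  have s: "s w \<in> topspace X" "q (s w) = w" if "w \<in> topspace W" for w
    using that surj by (auto simp: s_def inv_into_into f_inv_into_f)
  have sq: "s (q x) = x \<or> s (q x) \<in> A \<and> x \<in> A" if "x \<in> topspace X" for x
  proof -
    have "q x \<in> topspace W" using that surj by blast
    then show ?thesis using fib[of "s (q x)" x] s that by simp
  qed
  have qm: "quotient_map X W q" by (rule continuous_imp_quotient_map[OF q X W surj])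
  have p: "continuous_map X X p" using homotopic_with_imp_continuous_maps[OF hom] by blast
  have gq: "(p \<circ> s \<circ> q) x = p x" if "x \<in> topspace X" for x
    using sq[OF that] pA[of "s (q x)" x] by auto
  have "continuous_map X X (p \<circ> s \<circ> q)"
    by (rule continuous_map_eq[OF p]) (simp add: gq[symmetric])
  then have g: "continuous_map W X (p \<circ> s)" by (rule continuous_compose_quotient_map[OF qm])
  have "homotopic_with (\<lambda>x. True) X X p id"
    using hom homotopic_with_mono homotopic_with_symD by (metis (mono_tags, lifting))
  then have 1: "homotopic_with (\<lambda>x. True) X X (p \<circ> s \<circ> q) id"
    by (rule homotopic_with_eq) (use gq in auto)
  obtain h where h: "continuous_map (prod_topology ?I X) X h" "\<And>x. h (0, x) = x" "\<And>x. h (1, x) = p x"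
      "\<And>t. t \<in> {0..1} \<Longrightarrow> (\<lambda>x. h (t, x)) ` A \<subseteq> A"
    using hom unfolding homotopic_with_def by auto
  define k where "k = (\<lambda>(t::real, w). q (h (t, s w)))"
  define Q where "Q = (\<lambda>(t::real, x). (t, q x))"
  \<comment> \<open>The homotopy on \<open>W\<close> must descend along the product of
    \<open>q\<close> with the interval; compactness makes this product a quotient map as
    well.\<close>
  have "quotient_map (prod_topology ?I X) (prod_topology ?I W) Q"
  proof (rule continuous_imp_quotient_map)
    show "continuous_map (prod_topology ?I X) (prod_topology ?I W) Q"
      unfolding Q_def using q by (simp add: continuous_map_prod_top)
    have "compact_space ?I" by (simp add: compact_space_subtopology)
    then show "compact_space (prod_topology ?I X)"
      using X by (simp add: compact_space_prod_topology)
    have "Hausdorff_space ?I" by (simp add: Hausdorff_space_subtopology)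
    then show "Hausdorff_space (prod_topology ?I W)"
      using W by (simp add: Hausdorff_space_prod_topology)
    show "Q ` topspace (prod_topology ?I X) = topspace (prod_topology ?I W)"
      unfolding Q_def using surj by (force simp: image_iff)
  qed
  moreover have "continuous_map (prod_topology ?I X) W (k \<circ> Q)"
  proof (rule continuous_map_eq[OF continuous_map_compose[OF h(1) q]])
    fix z assume "z \<in> topspace (prod_topology ?I X)"
    then obtain t x where z: "z = (t, x)" "t \<in> {0..1}" "x \<in> topspace X" by auto
    \<comment> \<open>The homotopy keeps \<open>A\<close> inside \<open>A\<close>, and
      \<open>q\<close> sends \<open>A\<close> to one point.\<close>
    have "q (h (t, s (q x))) = q (h (t, x))"
      using sq[OF z(3)] h(4)[OF z(2)] qA by (metis image_subset_iff)
    then show "(q \<circ> h) z = (k \<circ> Q) z" by (simp add: z k_def Q_def)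
  qed
  ultimately have k: "continuous_map (prod_topology ?I W) W k"
    by (rule continuous_compose_quotient_map)
  have "homotopic_with (\<lambda>x. True) W W id (q \<circ> (p \<circ> s))"
    by (subst homotopic_with) (use k h(2,3) s in \<open>auto intro!: exI[of _ k] simp: k_def\<close>)
  then have 2: "homotopic_with (\<lambda>x. True) W W (q \<circ> (p \<circ> s)) id" by (rule homotopic_with_symD)
  show ?thesis unfolding homotopy_equivalent_space_def using q g 1 2 by blast
qed

section \<open>Top simplices, and extending a contraction of the complex left after their
  removal\<close>

locale top_faces =
  fixes K :: "'v set set" and \<Phi> :: "'v set set" and r :: nat
  assumes K: "simplicial_complex K" and \<Phi>: "\<Phi> \<subseteq> K" "\<And>\<sigma>. \<sigma> \<in> \<Phi> \<Longrightarrow> card \<sigma> = r" and r: "1 \<le> r"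
    and card_le: "\<And>\<sigma>. \<sigma> \<in> K \<Longrightarrow> card \<sigma> \<le> r"
begin

definition least_coord :: "'v set \<Rightarrow> ('v \<Rightarrow> real) \<Rightarrow> real" where
  "least_coord \<sigma> x = Min (x ` \<sigma>)"

lemma facetD:
  assumes "\<sigma> \<in> \<Phi>" shows "finite \<sigma>" "\<sigma> \<noteq> {}" "\<sigma> \<in> K"
  using assms \<Phi> r simplicial_complexD(3)[OF K] by fastforce+

lemma finite_facets: "finite \<Phi>"
  using \<Phi>(1) simplicial_complexD(2)[OF K] finite_subset by blast

lemma facet_maximal: "\<sigma> \<in> \<Phi> \<Longrightarrow> \<tau> \<in> K \<Longrightarrow> \<sigma> \<subseteq> \<tau> \<Longrightarrow> \<tau> = \<sigma>"
  using card_seteq[of \<tau> \<sigma>] simplicial_complexD(3)[OF K, of \<tau>] card_le[of \<tau>] \<Phi>(2)[of \<sigma>] by auto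

lemma simplicial_complex_Diff_facets: "simplicial_complex (K - \<Phi>)"
  unfolding simplicial_complex_def
proof (intro conjI ballI allI impI)
  show "finite (\<Union>(K - \<Phi>))"
    using simplicial_complexD(1)[OF K] by (rule finite_subset[rotated]) auto
  fix \<sigma> \<tau> assume *: "\<sigma> \<in> K - \<Phi>" "\<tau> \<subseteq> \<sigma>"
  then show "\<tau> \<in> K - \<Phi>"
    using facet_maximal[of \<tau> \<sigma>] simplicial_complexD(4)[OF K, of \<sigma> \<tau>] by auto
qed

lemma least_coord_le: "\<sigma> \<in> \<Phi> \<Longrightarrow> i \<in> \<sigma> \<Longrightarrow> least_coord \<sigma> x \<le> x i"
  using facetD(1) by (simp add: least_coord_def)

lemma least_coord_attained:
  assumes "\<sigma> \<in> \<Phi>" shows "\<exists>i\<in>\<sigma>. x i = least_coord \<sigma> x"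
proof -
  have "least_coord \<sigma> x \<in> x ` \<sigma>"
    unfolding least_coord_def using facetD[OF assms] by (intro Min_in) auto
  then show ?thesis by force
qed

text \<open>No face properly contains \<open>\<sigma>\<close>, since faces have at most
  \<open>r\<close> vertices. So \<open>least_coord \<sigma>\<close> is a bump function for the open
  simplex, and at a given point a sum over \<open>\<Phi>\<close> weighted by these has at most one
  nonzero term.\<close>

lemma least_coord_eq_0:
  assumes x: "x \<in> topspace (realization K)" and \<sigma>: "\<sigma> \<in> \<Phi>" and ne: "{v. x v \<noteq> 0} \<noteq> \<sigma>"
  shows "least_coord \<sigma> x = 0"
proof -
  have xD: "{v. x v \<noteq> 0} \<in> K" "\<And>v. 0 \<le> x v" using x by (auto simp: realization_iff[OF K])
  then have "\<not> \<sigma> \<subseteq> {v. x v \<noteq> 0}" using facet_maximal[OF \<sigma>] ne by blast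
  then obtain i where "i \<in> \<sigma>" "x i = 0" by blast
  then have "least_coord \<sigma> x \<le> 0" using least_coord_le[OF \<sigma>, of i x] by simp
  moreover have "0 \<le> least_coord \<sigma> x" using least_coord_attained[OF \<sigma>, of x] xD(2) by metis
  ultimately show ?thesis by simp
qed

lemma least_coord_pos:
  assumes x: "x \<in> topspace (realization K)" and \<sigma>: "\<sigma> \<in> \<Phi>" and eq: "{v. x v \<noteq> 0} = \<sigma>"
  shows "0 < least_coord \<sigma> x"
proof -
  obtain i where "i \<in> \<sigma>" "x i = least_coord \<sigma> x" using least_coord_attained[OF \<sigma>] by blast
  moreover have "0 \<le> x i" using x by (auto simp: realization_iff[OF K])
  ultimately show ?thesis using eq by (metis (mono_tags, lifting) less_eq_real_def mem_Collect_eq)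
qed

lemma sum_over_facets:
  assumes x: "x \<in> topspace (realization K)" and f: "\<And>\<tau>. least_coord \<tau> x = 0 \<Longrightarrow> f \<tau> = (0::real)"
  shows "{v. x v \<noteq> 0} \<notin> \<Phi> \<Longrightarrow> sum f \<Phi> = 0"
    "{v. x v \<noteq> 0} \<in> \<Phi> \<Longrightarrow> sum f \<Phi> = f {v. x v \<noteq> 0}"
proof -
  show "sum f \<Phi> = 0" if "{v. x v \<noteq> 0} \<notin> \<Phi>"
    using least_coord_eq_0[OF x] that f by (intro sum.neutral) metis
  show "sum f \<Phi> = f {v. x v \<noteq> 0}" if "{v. x v \<noteq> 0} \<in> \<Phi>"
  proof -
    have "sum f {{v. x v \<noteq> 0}} = sum f \<Phi>"
      using least_coord_eq_0[OF x] that f finite_facets by (intro sum.mono_neutral_left) auto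
    then show ?thesis by simp
  qed
qed

lemma in_realization_Diff:
  "x \<in> topspace (realization (K - \<Phi>)) \<longleftrightarrow> x \<in> topspace (realization K) \<and> {v. x v \<noteq> 0} \<notin> \<Phi>"
  by (auto simp: realization_def)

lemma continuous_map_least_coord:
  assumes "\<sigma> \<in> \<Phi>" shows "continuous_map (realization K) euclideanreal (least_coord \<sigma>)"
  unfolding least_coord_def[abs_def]
  using facetD[OF assms] by (intro continuous_map_Min continuous_map_coordinate)

definition excess :: "('v \<Rightarrow> real) \<Rightarrow> 'v \<Rightarrow> real" where
  "excess x i = (\<Sum>\<sigma>\<in>\<Phi>. if i \<in> \<sigma> then least_coord \<sigma> x else 0)"

text \<open>The factor \<open>r\<close> makes this 0 at a barycentre, where all \<open>r\<close>
  coordinates are 1/r; it is 1 on the realization of \<open>K - \<Phi>\<close>.\<close>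

definition radius :: "('v \<Rightarrow> real) \<Rightarrow> real" where
  "radius x = 1 - r * (\<Sum>\<sigma>\<in>\<Phi>. least_coord \<sigma> x)"

lemma excess_radius_boundary:
  assumes "x \<in> topspace (realization (K - \<Phi>))"
  shows "excess x i = 0" "radius x = 1"
  using assms unfolding in_realization_Diff excess_def radius_def
  by (auto simp: sum_over_facets(1))

lemma excess_radius_facet:
  fixes m :: real
  assumes x: "x \<in> topspace (realization K)" and \<sigma>: "{v. x v \<noteq> 0} \<in> \<Phi>"
  defines "m \<equiv> least_coord {v. x v \<noteq> 0} x"
  shows "excess x i = (if x i \<noteq> 0 then m else 0)" "radius x = 1 - r * m" "0 \<le> radius x" "radius x < 1"
proof -
  show "excess x i = (if x i \<noteq> 0 then m else 0)"
    unfolding excess_def m_def using x \<sigma> by (subst sum_over_facets(2)) auto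
  show rad: "radius x = 1 - r * m"
    unfolding radius_def m_def using x \<sigma> by (subst sum_over_facets(2)) auto
  have "card {v. x v \<noteq> 0} * m \<le> sum x {v. x v \<noteq> 0}"
    using least_coord_le[OF \<sigma>] by (intro sum_bounded_below) (auto simp: m_def)
  also have "\<dots> = 1" using sum_eq_1_superset[OF K x] facetD(1)[OF \<sigma>] by simp
  finally show "0 \<le> radius x" using rad \<Phi>(2)[OF \<sigma>] by simp
  show "radius x < 1" using rad r least_coord_pos[OF x \<sigma> refl] by (simp add: m_def)
qed

text \<open>In an open simplex of \<^term>\<open>\<Phi>\<close>, a point is a convex combination, with weights \<open>radius x\<close> and
  \<open>1 - radius x\<close>, of a boundary point and the barycentre (the latter part is \<open>excess x\<close>). At time \<open>t\<close>
  the two parts are rescaled so that at time \<open>1\<close> the radius has become \<open>min 1 (2 * radius x)\<close>.\<close>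

definition outer_scale :: "real \<Rightarrow> real \<Rightarrow> real" where
  "outer_scale t s = (1 - t) + t / max s (1/2)"

text \<open>At time 1 the weight \<open>1 - s\<close> becomes \<open>max 0 (1 - 2 * s)\<close>. The
  bound 1/2 in the denominator prevents division by 0 and takes effect only where the numerator
  vanishes.\<close>

definition inner_scale :: "real \<Rightarrow> real \<Rightarrow> real" where
  "inner_scale t s = (1 - t) + t * max 0 (1 - 2 * s) / max (1 - s) (1/2)"

definition expand :: "real \<Rightarrow> ('v \<Rightarrow> real) \<Rightarrow> 'v \<Rightarrow> real" where
  "expand t x i = outer_scale t (radius x) * (x i - excess x i) + inner_scale t (radius x) * excess x i"

lemma scale_weights:
  shows "outer_scale t s * s + inner_scale t s * (1 - s) = 1"
    "0 \<le> t \<Longrightarrow> t \<le> 1 \<Longrightarrow> 0 \<le> outer_scale t s" "0 \<le> t \<Longrightarrow> t \<le> 1 \<Longrightarrow> 0 \<le> inner_scale t s"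
proof -
  show "outer_scale t s * s + inner_scale t s * (1 - s) = 1"
  proof (cases "s \<le> 1/2")
    case True
    then have "max s (1/2) = 1/2" "max 0 (1 - 2 * s) = 1 - 2 * s" "max (1 - s) (1/2) = 1 - s" "1 - s \<noteq> 0"
      by auto
    then show ?thesis unfolding outer_scale_def inner_scale_def by (simp add: field_simps)
  next
    case False
    then have "max s (1/2) = s" "max 0 (1 - 2 * s) = 0" "s \<noteq> 0" by auto
    then show ?thesis unfolding outer_scale_def inner_scale_def by (simp add: field_simps)
  qed
  show "0 \<le> t \<Longrightarrow> t \<le> 1 \<Longrightarrow> 0 \<le> outer_scale t s" "0 \<le> t \<Longrightarrow> t \<le> 1 \<Longrightarrow> 0 \<le> inner_scale t s"
    by (auto simp: outer_scale_def inner_scale_def intro!: add_nonneg_nonneg divide_nonneg_nonneg mult_nonneg_nonneg)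
qed

lemma expand_0: "expand 0 x = x"
  by (auto simp: expand_def outer_scale_def inner_scale_def)

lemma expand_boundary:
  assumes "x \<in> topspace (realization (K - \<Phi>))" shows "expand t x = x"
  using excess_radius_boundary[OF assms] by (auto simp: expand_def outer_scale_def)

lemma expand_in:
  assumes t: "0 \<le> t" "t \<le> 1" and x: "x \<in> topspace (realization K)"
  shows "expand t x \<in> topspace (realization K)"
proof (cases "{v. x v \<noteq> 0} \<in> \<Phi>")
  case False
  then have "x \<in> topspace (realization (K - \<Phi>))" using x by (simp add: in_realization_Diff)
  then show ?thesis using expand_boundary x by simp
next
  case True
  let ?\<sigma> = "{v. x v \<noteq> 0}"
  let ?m = "least_coord ?\<sigma> x"
  note E = excess_radius_facet[OF x True]
  have supp: "{v. expand t x v \<noteq> 0} \<subseteq> ?\<sigma>" by (auto simp: expand_def E)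
  have "0 \<le> expand t x i" for i
    using scale_weights(2,3)[OF t] least_coord_pos[OF x True refl] least_coord_le[OF True, of i x]
    by (auto simp: expand_def E)
  moreover have "sum (expand t x) (\<Union>K) = 1"
  proof -
    have "sum (expand t x) (\<Union>K) = sum (expand t x) ?\<sigma>"
      using supp simplicial_complexD(1)[OF K] facetD(3)[OF True] by (intro sum.mono_neutral_right) auto
    also have "\<dots> = (\<Sum>i\<in>?\<sigma>. outer_scale t (radius x) * (x i - ?m) + inner_scale t (radius x) * ?m)"
      by (intro sum.cong) (auto simp: expand_def E(1))
    also have "\<dots> = outer_scale t (radius x) * (sum x ?\<sigma> - r * ?m) + inner_scale t (radius x) * (r * ?m)"
      using \<Phi>(2)[OF True] by (simp add: sum.distrib sum_subtractf flip: sum_distrib_left)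
    also have "sum x ?\<sigma> = 1" using sum_eq_1_superset[OF K x] facetD(1)[OF True] by simp
    also have "r * ?m = 1 - radius x" using E(2) by simp
    finally show ?thesis using scale_weights(1)[of t "radius x"] by simp
  qed
  moreover have "{v. expand t x v \<noteq> 0} \<in> K"
    using simplicial_complexD(4)[OF K facetD(3)[OF True] supp] .
  ultimately show ?thesis by (simp add: realization_iff[OF K])
qed

text \<open>From radius 1/2 on the barycentric part is dropped, so the vertex with the least
  coordinate receives 0.\<close>

lemma expand_1_in:
  assumes x: "x \<in> topspace (realization K)" and rad: "1/2 \<le> radius x"
  shows "expand 1 x \<in> topspace (realization (K - \<Phi>))"
proof (cases "{v. x v \<noteq> 0} \<in> \<Phi>")
  case False
  then have "x \<in> topspace (realization (K - \<Phi>))" using x by (simp add: in_realization_Diff)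
  then show ?thesis using expand_boundary by simp
next
  case True
  note E = excess_radius_facet[OF x True]
  have "inner_scale 1 (radius x) = 0" using rad by (simp add: inner_scale_def)
  then have e: "expand 1 x i = outer_scale 1 (radius x) * (x i - excess x i)" for i
    by (simp add: expand_def)
  obtain i where i: "x i \<noteq> 0" "x i = least_coord {v. x v \<noteq> 0} x"
    using least_coord_attained[OF True] by blast
  then have "expand 1 x i = 0" by (simp add: e E(1))
  moreover have supp: "{v. expand 1 x v \<noteq> 0} \<subseteq> {v. x v \<noteq> 0}" by (auto simp: e E(1))
  ultimately have "{v. expand 1 x v \<noteq> 0} \<subset> {v. x v \<noteq> 0}" using i(1) by blast
  then have "{v. expand 1 x v \<noteq> 0} \<notin> \<Phi>"
    using facet_maximal[of "{v. expand 1 x v \<noteq> 0}" "{v. x v \<noteq> 0}"] facetD(3)[OF True] by blast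
  then show ?thesis using expand_in[of 1 x] x by (simp add: in_realization_Diff)
qed

lemma continuous_map_radius: "continuous_map (realization K) euclideanreal radius"
  unfolding radius_def[abs_def]
  by (intro continuous_intros finite_facets continuous_map_least_coord) auto

lemma continuous_map_excess: "continuous_map (realization K) euclideanreal (\<lambda>x. excess x i)"
  unfolding excess_def
  by (intro continuous_map_sum finite_facets continuous_map_if continuous_map_least_coord) auto

lemma continuous_map_expand:
  assumes t: "continuous_map Z euclideanreal t" and x: "continuous_map Z (realization K) x"
  shows "continuous_map Z euclideanreal (\<lambda>z. expand (t z) (x z) i)"
proof -
  have "continuous_map Z euclideanreal (\<lambda>z. radius (x z))" "continuous_map Z euclideanreal (\<lambda>z. excess (x z) i)"
    "continuous_map Z euclideanreal (\<lambda>z. x z i)"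
    using continuous_map_compose[OF x continuous_map_radius] continuous_map_compose[OF x continuous_map_excess]
      continuous_map_compose[OF x continuous_map_coordinate] by (simp_all add: o_def)
  then show ?thesis
    unfolding expand_def outer_scale_def inner_scale_def
    by (intro continuous_intros t) (auto simp: max_def)
qed

text \<open>Homotopy extension by a collar: \<open>expand\<close> stretches the inner half of each
  simplex over the whole simplex and pushes the outer half to the boundary; then the given
  contraction is run on the outer half, damped towards its inner rim.\<close>

lemma contraction_extends:
  assumes contr: "contractible_space (realization (K - \<Phi>))"
  defines "A \<equiv> topspace (realization (K - \<Phi>))"
  obtains p where "homotopic_with (\<lambda>f. f ` A \<subseteq> A) (realization K) (realization K) id p"
    and "\<And>x y. x \<in> A \<Longrightarrow> y \<in> A \<Longrightarrow> p x = p y"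
proof -
  let ?I = "top_of_set {0..1::real}"
  let ?X = "realization K"
  let ?C = "realization (K - \<Phi>)"
  let ?Z = "prod_topology ?I ?X"
  obtain a H where H: "continuous_map (prod_topology ?I ?C) ?C H" "\<And>x. H (0, x) = x" "\<And>x. H (1, x) = a"
    using contr unfolding contractible_space_def homotopic_with_def by auto
  have fst: "continuous_map ?Z euclideanreal fst"
    using continuous_map_fst[of ?I] continuous_map_into_fulltopology by blast
  have snd: "continuous_map ?Z ?X snd" by (rule continuous_map_snd)
  have rad: "continuous_map ?Z euclideanreal (\<lambda>z. radius (snd z))"
    using continuous_map_compose[OF snd continuous_map_radius] by (simp add: o_def)
  have "homotopic_with (\<lambda>f. f ` A \<subseteq> A) ?X ?X id (expand 1)"
    unfolding homotopic_with_def
  proof (intro exI conjI ballI)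
    show "continuous_map ?Z ?X (\<lambda>z. expand (fst z) (snd z))"
      using continuous_map_expand[OF fst snd] expand_in by (auto simp: continuous_map_realization)
    show "(\<lambda>x. expand (fst (t, x)) (snd (t, x))) ` A \<subseteq> A" for t
      using expand_boundary by (auto simp: A_def)
  qed (auto simp: expand_0)
  \<comment> \<open>The time passed to \<open>H\<close> is 0 at radius 1/2, where the branches agree
    because \<open>H\<close> starts at the identity, and it is the full time on \<open>A\<close>,
    where the radius is 1.\<close>
  moreover define R where "R z = (if radius (snd z) \<le> 1/2 then expand 1 (snd z)
      else H (fst z * (2 * radius (snd z) - 1), expand 1 (snd z)))" for z
  have R_boundary: "R (t, x) = H (t, x)" if "x \<in> A" for t x
    using that expand_boundary excess_radius_boundary by (simp add: R_def A_def)
  have rad_le: "radius x \<le> 1" if "x \<in> topspace ?X" for x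
    using excess_radius_facet(4)[OF that] excess_radius_boundary(2) that
    by (metis in_realization_Diff less_eq_real_def order_refl)
  have "homotopic_with (\<lambda>f. f ` A \<subseteq> A) ?X ?X (expand 1) (\<lambda>x. R (1, x))"
    unfolding homotopic_with_def
  proof (intro exI conjI ballI allI)
    show "continuous_map ?Z ?X R"
      unfolding R_def
    proof (rule continuous_map_cases_le)
      show "continuous_map (subtopology ?Z {z \<in> topspace ?Z. radius (snd z) \<le> 1 / 2}) ?X (\<lambda>z. expand 1 (snd z))"
        using continuous_map_expand[OF _ snd, of "\<lambda>_. 1"] expand_in
        by (intro continuous_map_from_subtopology) (auto simp: continuous_map_realization)
      let ?S = "subtopology ?Z {z \<in> topspace ?Z. 1 / 2 \<le> radius (snd z)}"
      have 1: "continuous_map ?S ?C (\<lambda>z. expand 1 (snd z))"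
        using continuous_map_expand[OF _ snd, of "\<lambda>_. 1"] expand_1_in
        by (auto simp: continuous_map_realization intro!: continuous_map_from_subtopology)
      have "continuous_map ?S euclideanreal (\<lambda>z. fst z * (2 * radius (snd z) - 1))"
        by (intro continuous_map_from_subtopology) (intro continuous_intros fst rad)
      moreover have "fst z * (2 * radius (snd z) - 1) \<in> {0..1}" if "z \<in> topspace ?S" for z
      proof -
        have "0 \<le> fst z" "fst z \<le> 1" "0 \<le> 2 * radius (snd z) - 1" "2 * radius (snd z) - 1 \<le> 1"
          using that rad_le by auto
        then show ?thesis by (auto intro: mult_le_one)
      qed
      ultimately have "continuous_map ?S ?I (\<lambda>z. fst z * (2 * radius (snd z) - 1))"
        by (auto simp: continuous_map_in_subtopology)
      then have "continuous_map ?S ?C (H \<circ> (\<lambda>z. (fst z * (2 * radius (snd z) - 1), expand 1 (snd z))))"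
        using 1 by (intro continuous_map_compose[OF _ H(1)]) (simp add: continuous_map_pairwise o_def)
      then show "continuous_map ?S ?X (\<lambda>z. H (fst z * (2 * radius (snd z) - 1), expand 1 (snd z)))"
        unfolding continuous_map_realization o_def by (simp add: in_realization_Diff)
      show "expand 1 (snd z) = H (fst z * (2 * radius (snd z) - 1), expand 1 (snd z))"
        if "z \<in> topspace ?Z" "radius (snd z) = 1 / 2" for z
      proof -
        have "fst z * (2 * radius (snd z) - 1) = 0" using that(2) by simp
        then show ?thesis by (simp only: H(2))
      qed
    qed (use rad in auto)
    show "R (0, x) = expand 1 x" for x by (simp add: R_def H(2))
    show "R (1, x) = R (1, x)" for x by simp
    show "(\<lambda>x. R (t, x)) ` A \<subseteq> A" if t: "t \<in> {0..1}" for t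
    proof (intro image_subsetI)
      fix x assume x: "x \<in> A"
      have "H (t, x) \<in> topspace ?C"
        using continuous_map_funspace[OF H(1)] t x by (auto simp: A_def)
      then show "R (t, x) \<in> A" using R_boundary[OF x] by (simp add: A_def)
    qed
  qed
  ultimately have "homotopic_with (\<lambda>f. f ` A \<subseteq> A) ?X ?X id (\<lambda>x. R (1, x))"
    by (rule homotopic_with_trans)
  moreover have "R (1, x) = R (1, y)" if "x \<in> A" "y \<in> A" for x y
    using that H(3) R_boundary by simp
  ultimately show thesis by (rule that)
qed

end

section \<open>Mapping to the wedge of spheres\<close>

text \<open>Each open \<open>d\<close>-simplex of \<^term>\<open>\<Phi>\<close> is mapped homeomorphically onto a sphere of the wedge minus the
  base point. The inversion \<open>p \<mapsto> p / |p|\<^sup>2\<close> turns the \<open>j\<close>-th sphere into the hyperplane \<open>x\<^sub>0 = 1 / (2 j)\<close>, and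
  the open simplex is identified with this hyperplane via \<open>(x\<^sub>i - x\<^sub>0) / m\<close>, where \<open>m\<close> is the least
  barycentric coordinate. In \<open>wedge_map\<close>, the summand \<open>(1 - \<Sum>x)\<^sup>2\<close> vanishes on the simplex itself and keeps
  the denominator away from 0 on the rest of the complex.\<close>

locale wedge_charts = top_faces K \<Phi> "Suc d" for K \<Phi> :: "'v set set" and d :: nat +
  fixes j :: "'v set \<Rightarrow> nat" and k :: nat and e :: "'v set \<Rightarrow> nat \<Rightarrow> 'v"
  assumes j: "bij_betw j \<Phi> {1..k}" and e: "\<And>\<sigma>. \<sigma> \<in> \<Phi> \<Longrightarrow> bij_betw (e \<sigma>) {..d} \<sigma>"
begin

text \<open>This is m times the point y of the hyperplane, m being the least coordinate, so that no
  division by m occurs: the inversion of y is m times the chart divided by its squared norm.\<close>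

definition chart :: "'v set \<Rightarrow> ('v \<Rightarrow> real) \<Rightarrow> nat \<Rightarrow> real" where
  "chart \<sigma> x i = (if i = 0 then least_coord \<sigma> x / (2 * real (j \<sigma>))
                  else if i \<le> d then x (e \<sigma> i) - x (e \<sigma> 0) else 0)"

definition wedge_map :: "('v \<Rightarrow> real) \<Rightarrow> nat \<Rightarrow> real" where
  "wedge_map x i = (\<Sum>\<sigma>\<in>\<Phi>. least_coord \<sigma> x * chart \<sigma> x i /
                      ((\<Sum>l\<le>d. (chart \<sigma> x l)\<^sup>2) + (1 - sum x \<sigma>)\<^sup>2))"

lemma j_pos: "\<sigma> \<in> \<Phi> \<Longrightarrow> 0 < j \<sigma>" "\<sigma> \<in> \<Phi> \<Longrightarrow> j \<sigma> \<le> k"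
  using bij_betwE[OF j] by fastforce+

lemma e_onto: "\<sigma> \<in> \<Phi> \<Longrightarrow> v \<in> \<sigma> \<Longrightarrow> \<exists>i\<le>d. e \<sigma> i = v"
  using e[of \<sigma>] unfolding bij_betw_def by force

lemma e_in: "\<sigma> \<in> \<Phi> \<Longrightarrow> i \<le> d \<Longrightarrow> e \<sigma> i \<in> \<sigma>"
  using e[of \<sigma>] unfolding bij_betw_def by force

text \<open>If the chart vanishes, all coordinates on \<open>\<sigma>\<close> are equal and their
  minimum is 0, so they cannot sum to 1.\<close>

lemma denominator_nonzero:
  assumes \<sigma>: "\<sigma> \<in> \<Phi>"
  shows "(\<Sum>l\<le>d. (chart \<sigma> x l)\<^sup>2) + (1 - sum x \<sigma>)\<^sup>2 \<noteq> 0"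
proof
  assume "(\<Sum>l\<le>d. (chart \<sigma> x l)\<^sup>2) + (1 - sum x \<sigma>)\<^sup>2 = 0"
  moreover have "0 \<le> (\<Sum>l\<le>d. (chart \<sigma> x l)\<^sup>2)" by (intro sum_nonneg) simp
  ultimately have 0: "(\<Sum>l\<le>d. (chart \<sigma> x l)\<^sup>2) = 0" and sum: "sum x \<sigma> = 1"
    using zero_le_power2[of "1 - sum x \<sigma>"] by (smt (verit) zero_eq_power2)+
  have chart: "chart \<sigma> x l = 0" if "l \<le> d" for l
    using 0 that by (subst (asm) sum_nonneg_eq_0_iff) auto
  have const: "x v = x (e \<sigma> 0)" if v: "v \<in> \<sigma>" for v
  proof -
    obtain i where "i \<le> d" "e \<sigma> i = v" using e_onto[OF \<sigma> v] by blast
    then show ?thesis using chart[of i] by (cases "i = 0") (auto simp: chart_def)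
  qed
  have "least_coord \<sigma> x = 0" using chart[of 0] j_pos[OF \<sigma>] by (simp add: chart_def)
  then obtain i where "i \<in> \<sigma>" "x i = 0" using least_coord_attained[OF \<sigma>, of x] by auto
  then have "sum x \<sigma> = 0" using const by (intro sum.neutral) metis
  then show False using sum by simp
qed

lemma wedge_map_boundary:
  assumes "x \<in> topspace (realization (K - \<Phi>))"
  shows "wedge_map x = (\<lambda>_. 0)"
  using assms unfolding in_realization_Diff wedge_map_def
  by (intro ext) (auto intro: sum_over_facets(1))

lemma wedge_map_facet:
  assumes x: "x \<in> topspace (realization K)" and \<sigma>: "\<sigma> \<in> \<Phi>" "{v. x v \<noteq> 0} = \<sigma>"
  defines "m \<equiv> least_coord \<sigma> x" and "N \<equiv> (\<Sum>l\<le>d. (chart \<sigma> x l)\<^sup>2)"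
  shows "0 < m" "0 < N" "wedge_map x i = m * chart \<sigma> x i / N"
    "(\<Sum>i\<le>d. (wedge_map x i)\<^sup>2) = m\<^sup>2 / N" "2 * real (j \<sigma>) * wedge_map x 0 = m\<^sup>2 / N"
proof -
  show m: "0 < m" unfolding m_def using least_coord_pos[OF x \<sigma>] .
  have "sum x \<sigma> = 1" using sum_eq_1_superset[OF K x] facetD(1)[OF \<sigma>(1)] \<sigma>(2) by simp
  moreover have "0 \<le> N" unfolding N_def by (intro sum_nonneg) simp
  ultimately show N: "0 < N" using denominator_nonzero[OF \<sigma>(1), of x] by (simp add: N_def)
  have *: "wedge_map x i = m * chart \<sigma> x i / N" for i
    using sum_over_facets(2)[OF x, of "\<lambda>\<sigma>. least_coord \<sigma> x * chart \<sigma> x i /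
                      ((\<Sum>l\<le>d. (chart \<sigma> x l)\<^sup>2) + (1 - sum x \<sigma>)\<^sup>2)"] \<sigma> \<open>sum x \<sigma> = 1\<close>
    by (simp add: wedge_map_def m_def N_def)
  then show "wedge_map x i = m * chart \<sigma> x i / N" .
  have "(\<Sum>i\<le>d. (wedge_map x i)\<^sup>2) = (\<Sum>i\<le>d. (m / N)\<^sup>2 * (chart \<sigma> x i)\<^sup>2)"
    by (simp add: * power_mult_distrib power_divide)
  also have "\<dots> = (m / N)\<^sup>2 * N" by (simp add: N_def sum_distrib_left)
  finally show "(\<Sum>i\<le>d. (wedge_map x i)\<^sup>2) = m\<^sup>2 / N" using N by (simp add: power2_eq_square)
  show "2 * real (j \<sigma>) * wedge_map x 0 = m\<^sup>2 / N"
    using j_pos(1)[OF \<sigma>(1)] by (simp add: * chart_def power2_eq_square m_def)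
qed

lemma topspace_wedge:
  "p \<in> topspace (wedge_of_spheres k d) \<longleftrightarrow>
     (\<forall>i>d. p i = 0) \<and> (p = (\<lambda>_. 0) \<or> (\<exists>j\<in>{1..k}. (\<Sum>i\<le>d. (p i)\<^sup>2) = 2 * real j * p 0))"
  by (auto simp: wedge_of_spheres_def)

lemma wedge_map_in:
  assumes x: "x \<in> topspace (realization K)"
  shows "wedge_map x \<in> topspace (wedge_of_spheres k d)"
proof (cases "{v. x v \<noteq> 0} \<in> \<Phi>")
  case False
  then show ?thesis using x wedge_map_boundary by (simp add: in_realization_Diff topspace_wedge)
next
  case True
  note W = wedge_map_facet[OF x True refl]
  have "wedge_map x i = 0" if "i > d" for i using that by (simp add: W(3) chart_def)
  moreover have "j {v. x v \<noteq> 0} \<in> {1..k}" using j_pos[OF True] by simp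
  moreover have "(\<Sum>i\<le>d. (wedge_map x i)\<^sup>2) = 2 * real (j {v. x v \<noteq> 0}) * wedge_map x 0"
    using W(4,5) by simp
  ultimately show ?thesis unfolding topspace_wedge by blast
qed

lemma continuous_map_wedge_map: "continuous_map (realization K) (wedge_of_spheres k d) wedge_map"
proof -
  have chart: "continuous_map (realization K) euclideanreal (\<lambda>x. chart \<sigma> x i)" if "\<sigma> \<in> \<Phi>" for \<sigma> i
    unfolding chart_def using j_pos[OF that]
    by (intro continuous_intros continuous_map_coordinate continuous_map_least_coord[OF that]) auto
  have "continuous_map (realization K) euclideanreal (\<lambda>x. wedge_map x i)" for i
    unfolding wedge_map_def
    by (intro continuous_map_sum finite_facets continuous_map_real_divide denominator_nonzero)
       (intro continuous_intros chart continuous_map_coordinate continuous_map_least_coord facetD(1); simp)+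
  then have "continuous_map (realization K) (powertop_real UNIV) wedge_map"
    by (simp add: continuous_map_componentwise_UNIV)
  moreover have "wedge_map \<in> topspace (realization K) \<rightarrow> topspace (wedge_of_spheres k d)"
    using wedge_map_in by blast
  ultimately show ?thesis unfolding wedge_of_spheres_def
    by (simp add: continuous_map_in_subtopology)
qed

text \<open>After division by the least coordinate both points have minimum 1, which forces the
  translation \<open>c\<close> to be 0; the total mass 1 then fixes the scale.\<close>

lemma facet_point_eqI:
  assumes x: "x \<in> topspace (realization K)" and y: "y \<in> topspace (realization K)"
    and \<sigma>: "\<sigma> \<in> \<Phi>" "{v. x v \<noteq> 0} = \<sigma>" "{v. y v \<noteq> 0} = \<sigma>"
    and diff: "\<And>i. i \<in> \<sigma> \<Longrightarrow> x i / least_coord \<sigma> x - y i / least_coord \<sigma> y = c"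
  shows "x = y"
proof -
  let ?m = "least_coord \<sigma> x" and ?n = "least_coord \<sigma> y"
  have pos: "0 < ?m" "0 < ?n" using least_coord_pos[OF _ \<sigma>(1)] x y \<sigma> by blast+
  obtain a where a: "a \<in> \<sigma>" "x a = ?m" using least_coord_attained[OF \<sigma>(1)] by blast
  obtain b where b: "b \<in> \<sigma>" "y b = ?n" using least_coord_attained[OF \<sigma>(1)] by blast
  have "1 \<le> y a / ?n" "1 \<le> x b / ?m"
    using least_coord_le[OF \<sigma>(1)] a(1) b(1) pos by simp_all
  moreover have "x a / ?m = 1" "y b / ?n = 1" using a(2) b(2) pos by simp_all
  ultimately have "c = 0" using diff[OF a(1)] diff[OF b(1)] by linarith
  then have scale: "x i = ?m / ?n * y i" if "i \<in> \<sigma>" for i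
    using diff[OF that] pos by (simp add: field_simps)
  then have "sum x \<sigma> = ?m / ?n * sum y \<sigma>" by (simp add: sum_distrib_left)
  moreover have "sum x \<sigma> = 1" "sum y \<sigma> = 1"
    using sum_eq_1_superset[OF K] x y facetD(1)[OF \<sigma>(1)] \<sigma> by simp_all
  ultimately have "?m / ?n = 1" by simp
  show "x = y"
  proof
    fix i show "x i = y i"
    proof (cases "i \<in> \<sigma>")
      case True
      then show ?thesis using scale \<open>?m / ?n = 1\<close> by simp
    next
      case False
      then have "x i = 0" "y i = 0" using \<sigma>(2,3) by blast+
      then show ?thesis by simp
    qed
  qed
qed

text \<open>For an image p other than the origin, \<open>j\<close> is read off from |p|^2 = 2 j p_0,
  and inverting p recovers the chart divided by the least coordinate.\<close>

lemma wedge_map_eqD: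
  assumes x: "x \<in> topspace (realization K)" and y: "y \<in> topspace (realization K)"
    and eq: "wedge_map x = wedge_map y" and xf: "{v. x v \<noteq> 0} \<in> \<Phi>"
  shows "x = y"
proof -
  let ?\<sigma> = "{v. x v \<noteq> 0}"
  note X = wedge_map_facet[OF x xf refl]
  define N where "N = (\<Sum>i\<le>d. (wedge_map x i)\<^sup>2)"
  have N: "0 < N" using X(1,2) by (simp add: N_def X(4))
  have yf: "{v. y v \<noteq> 0} \<in> \<Phi>"
  proof (rule ccontr)
    assume "\<not> ?thesis"
    then have "wedge_map x = (\<lambda>_. 0)" using y wedge_map_boundary eq by (simp add: in_realization_Diff)
    then show False using N by (simp add: N_def)
  qed
  note Y = wedge_map_facet[OF y yf refl]
  have "2 * real (j ?\<sigma>) * wedge_map x 0 = N" "2 * real (j {v. y v \<noteq> 0}) * wedge_map x 0 = N"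
    using X(4,5) Y(4,5) eq by (simp_all add: N_def)
  then have "wedge_map x 0 \<noteq> 0" "2 * real (j ?\<sigma>) * wedge_map x 0 = 2 * real (j {v. y v \<noteq> 0}) * wedge_map x 0"
    using N by auto
  then have "j ?\<sigma> = j {v. y v \<noteq> 0}" by simp
  then have supp: "{v. y v \<noteq> 0} = ?\<sigma>"
    using j xf yf unfolding bij_betw_def inj_on_def by metis
  let ?m = "least_coord ?\<sigma> x" and ?n = "least_coord ?\<sigma> y"
  have ratio: "chart ?\<sigma> x i / ?m = chart ?\<sigma> y i / ?n" for i
  proof -
    have "wedge_map x i / N = chart ?\<sigma> x i / ?m"
      using X(1,2) by (simp add: N_def X(4)) (simp add: X(3) power2_eq_square)
    moreover have "N = (\<Sum>i\<le>d. (wedge_map y i)\<^sup>2)" by (simp add: N_def eq)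
    then have "wedge_map y i / N = chart ?\<sigma> y i / ?n"
      using Y(1,2) unfolding supp by (simp add: Y(4)[unfolded supp]) (simp add: Y(3)[unfolded supp] power2_eq_square)
    ultimately show ?thesis using eq by simp
  qed
  show ?thesis
  proof (rule facet_point_eqI[OF x y xf refl supp])
    fix v assume "v \<in> ?\<sigma>"
    then obtain i where i: "i \<le> d" "e ?\<sigma> i = v" using e_onto[OF xf] by blast
    show "x v / ?m - y v / ?n = x (e ?\<sigma> 0) / ?m - y (e ?\<sigma> 0) / ?n"
    proof (cases "i = 0")
      case False
      then have "(x v - x (e ?\<sigma> 0)) / ?m = (y v - y (e ?\<sigma> 0)) / ?n"
        using ratio[of i] i by (simp add: chart_def)
      then show ?thesis by (simp add: diff_divide_distrib)
    qed (use i in simp)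
  qed
qed

lemma wedge_map_onto:
  assumes p: "p \<in> topspace (wedge_of_spheres k d)" "p \<noteq> (\<lambda>_. 0)"
  shows "\<exists>x\<in>topspace (realization K). wedge_map x = p"
proof -
  obtain j0 where j0: "j0 \<in> {1..k}" "(\<Sum>i\<le>d. (p i)\<^sup>2) = 2 * real j0 * p 0"
    using p by (auto simp: topspace_wedge)
  have p0: "p i = 0" if "i > d" for i using p that by (simp add: topspace_wedge)
  obtain \<sigma> where \<sigma>: "\<sigma> \<in> \<Phi>" "j \<sigma> = j0" using j0(1) bij_betw_imp_surj_on[OF j] by (metis imageE)
  define N where "N = (\<Sum>i\<le>d. (p i)\<^sup>2)"
  have "N \<noteq> 0"
  proof
    assume "N = 0"
    then have "p i = 0" if "i \<le> d" for i
      using that unfolding N_def by (subst (asm) sum_nonneg_eq_0_iff) auto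
    then show False using p(2) p0 by (meson ext not_le)
  qed
  moreover have "0 \<le> N" unfolding N_def by (intro sum_nonneg) simp
  ultimately have N: "0 < N" by simp
  \<comment> \<open>Inversion of \<open>p\<close> gives \<open>p i / N\<close>. Entry 0 is constant
    on the hyperplane; it is replaced by the difference of the coordinate at
    \<open>e \<sigma> 0\<close> with itself.\<close>
  define u where "u i = (if i = 0 then 0 else p i / N)" for i
  define \<mu> where "\<mu> = Min (u ` {..d})"
  have \<mu>_le: "\<mu> \<le> u i" if "i \<le> d" for i using that by (simp add: \<mu>_def)
  have "\<mu> \<in> u ` {..d}" unfolding \<mu>_def by (intro Min_in) auto
  then obtain i0 where i0: "i0 \<le> d" "u i0 = \<mu>" by force
  \<comment> \<open>The translation makes the least entry 1; division by the sum then yields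
    barycentric coordinates with least value \<open>1 / Z\<close>.\<close>
  define z where "z i = 1 - \<mu> + u i" for i
  define Z where "Z = (\<Sum>i\<le>d. z i)"
  have z: "1 \<le> z i" if "i \<le> d" for i using \<mu>_le[OF that] by (simp add: z_def)
  have "(\<Sum>i\<le>d. 1) \<le> Z" unfolding Z_def using z by (intro sum_mono) auto
  then have Z: "0 < Z" by simp
  define x where "x v = (if v \<in> \<sigma> then z (inv_into {..d} (e \<sigma>) v) / Z else 0)" for v
  have xe: "x (e \<sigma> i) = z i / Z" if "i \<le> d" for i
    using that e_in[OF \<sigma>(1) that] e[OF \<sigma>(1)] by (simp add: x_def bij_betw_def inv_into_f_f)
  have x_ge: "1 / Z \<le> x v" if v: "v \<in> \<sigma>" for v
  proof -
    obtain i where "i \<le> d" "e \<sigma> i = v" using e_onto[OF \<sigma>(1) v] by blast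
    then show ?thesis using xe[of i] z[of i] Z by (auto simp: divide_right_mono)
  qed
  then have "x v \<noteq> 0" if "v \<in> \<sigma>" for v using that Z by (smt (verit) divide_pos_pos)
  then have supp: "{v. x v \<noteq> 0} = \<sigma>" by (auto simp: x_def)
  have "sum x \<sigma> = (\<Sum>i\<le>d. x (e \<sigma> i))"
    using sum.reindex_bij_betw[OF e[OF \<sigma>(1)], of x] by simp
  also have "\<dots> = (\<Sum>i\<le>d. z i / Z)" using xe by (intro sum.cong) auto
  also have "\<dots> = 1" using Z by (simp add: Z_def flip: sum_divide_distrib)
  finally have "sum x \<sigma> = 1" .
  moreover have "0 \<le> x v" for v
    using x_ge[of v] Z by (cases "v \<in> \<sigma>") (auto simp: x_def intro: order_trans[of 0 "1 / Z"])
  ultimately have x: "x \<in> topspace (realization K)"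
    using supp facetD(3)[OF \<sigma>(1)] by (simp add: realization_def)
  have m: "least_coord \<sigma> x = 1 / Z"
  proof (rule antisym)
    have "x (e \<sigma> i0) = 1 / Z" using xe[OF i0(1)] i0(2) by (simp add: z_def)
    then show "least_coord \<sigma> x \<le> 1 / Z" using least_coord_le[OF \<sigma>(1) e_in[OF \<sigma>(1) i0(1)], of x] by simp
    show "1 / Z \<le> least_coord \<sigma> x" using least_coord_attained[OF \<sigma>(1), of x] x_ge by metis
  qed
  have chart: "chart \<sigma> x i = p i / (Z * N)" for i
  proof -
    consider "i = 0" | "i \<noteq> 0" "i \<le> d" | "i \<noteq> 0" "i > d" by linarith
    then show ?thesis
    proof cases
      case 1
      have "p 0 = N / (2 * real j0)" using j0 by (simp add: N_def)
      then show ?thesis using 1 N by (simp add: chart_def m \<sigma>(2))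
    next
      case 2
      then show ?thesis by (simp add: chart_def xe z_def u_def diff_divide_distrib[symmetric])
    next
      case 3
      then show ?thesis by (simp add: chart_def p0)
    qed
  qed
  have "(\<Sum>l\<le>d. (chart \<sigma> x l)\<^sup>2) = N / (Z * N)\<^sup>2"
    unfolding chart power_divide N_def by (simp flip: sum_divide_distrib)
  then have "wedge_map x i = p i" for i
    using wedge_map_facet(3)[OF x \<sigma>(1) supp, of i] Z N
    by (simp add: m chart power2_eq_square)
  then show ?thesis using x by blast
qed

lemma realization_homotopy_equivalent_wedge:
  assumes contr: "contractible_space (realization (K - \<Phi>))"
    and ne: "topspace (realization (K - \<Phi>)) \<noteq> {}"
  shows "realization K homotopy_equivalent_space wedge_of_spheres k d"
proof -
  let ?A = "topspace (realization (K - \<Phi>))"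
  obtain p where p: "homotopic_with (\<lambda>f. f ` ?A \<subseteq> ?A) (realization K) (realization K) id p"
    "\<And>x y. x \<in> ?A \<Longrightarrow> y \<in> ?A \<Longrightarrow> p x = p y"
    using contraction_extends[OF contr] by blast
  show ?thesis
  proof (rule quotient_homotopy_equivalent[OF _ _ continuous_map_wedge_map _ _ _ _ p])
    show "compact_space (realization K)" by (rule compact_space_realization[OF K])
    show "Hausdorff_space (wedge_of_spheres k d)"
      unfolding wedge_of_spheres_def
      by (intro Hausdorff_space_subtopology) (simp add: Hausdorff_space_product_topology)
    show "wedge_map ` topspace (realization K) = topspace (wedge_of_spheres k d)"
    proof
      show "wedge_map ` topspace (realization K) \<subseteq> topspace (wedge_of_spheres k d)"
        using wedge_map_in by blast
      \<comment> \<open>The wedge point is hit only by the subcomplex, which must therefore be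
        nonempty.\<close>
      obtain a where a: "a \<in> ?A" using ne by blast
      show "topspace (wedge_of_spheres k d) \<subseteq> wedge_map ` topspace (realization K)"
      proof
        fix w assume w: "w \<in> topspace (wedge_of_spheres k d)"
        show "w \<in> wedge_map ` topspace (realization K)"
        proof (cases "w = (\<lambda>_. 0)")
          case True
          then have "w = wedge_map a" using wedge_map_boundary[OF a] by simp
          then show ?thesis using a by (simp add: in_realization_Diff)
        next
          case False
          then show ?thesis using wedge_map_onto[OF w] by blast
        qed
      qed
    qed
    show "?A \<subseteq> topspace (realization K)" by (auto simp: in_realization_Diff)
    show "x = y \<or> x \<in> ?A \<and> y \<in> ?A"
      if "x \<in> topspace (realization K)" "y \<in> topspace (realization K)" "wedge_map x = wedge_map y" for x y
      using wedge_map_eqD[OF that] wedge_map_eqD[OF that(2,1) that(3)[symmetric]] that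
      by (auto simp: in_realization_Diff)
    show "wedge_map x = wedge_map y" if "x \<in> ?A" "y \<in> ?A" for x y
      using that by (simp add: wedge_map_boundary)
  qed
qed

end

theorem collapsible_mod_imp_wedge:
  assumes cK: "simplicial_complex K" "{} \<in> K" and coll: "collapsible_mod K k (Suc d)"
  shows "realization K homotopy_equivalent_space wedge_of_spheres k d"
proof -
  obtain \<Phi> where top: "\<Phi> \<subseteq> K" "finite \<Phi>" "card \<Phi> = k" "\<forall>\<sigma>\<in>\<Phi>. card \<sigma> = Suc d" "collapsible (K - \<Phi>)"
    and le: "\<forall>\<sigma>\<in>K. card \<sigma> \<le> Suc d"
    using coll by (auto simp: collapsible_mod_def)
  interpret top_faces K \<Phi> "Suc d"
  proof unfold_locales
    show "simplicial_complex K" "\<Phi> \<subseteq> K" "1 \<le> Suc d" using cK(1) top(1) by simp_all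
  qed (use top(4) le in blast)+
  obtain j where j: "bij_betw j \<Phi> {1..k}"
    using finite_same_card_bij[of \<Phi> "{1..k}"] top(2,3) by auto
  have "\<exists>e. bij_betw e {..d} \<sigma>" if "\<sigma> \<in> \<Phi>" for \<sigma>
    using finite_same_card_bij[of "{..d}" \<sigma>] facetD(1)[OF that] top(4) that by auto
  then obtain e where e: "\<And>\<sigma>. \<sigma> \<in> \<Phi> \<Longrightarrow> bij_betw (e \<sigma>) {..d} \<sigma>" by metis
  interpret wedge_charts K \<Phi> d j k e using j e by unfold_locales
  have "{} \<notin> \<Phi>" using top(4) by auto
  then have "K - \<Phi> \<noteq> {}" using cK(2) by blast
  then show ?thesis
    using collapsible_imp_contractible[OF top(5) simplicial_complex_Diff_facets]
      realization_homotopy_equivalent_wedge by blast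
qed

section \<open>Links in the Whitehouse complex\<close>

definition face_hierarchy :: "nat \<Rightarrow> nat set set \<Rightarrow> nat set set" where
  "face_hierarchy n F = insert {2..n} (F \<union> (\<lambda>i. {i}) ` {2..n})"

lemma whitehouse_vertexD:
  assumes "n \<ge> 3" "S \<in> whitehouse_vertices n"
  shows "S \<subseteq> {2..n}" "S \<noteq> {}" "S \<noteq> {2..n}" "S \<noteq> {i}"
  using assms by (auto simp: whitehouse_vertices_def)

lemma whitehouse_vertexI:
  assumes "S \<subseteq> {2..n}" "S \<noteq> {}" "S \<noteq> {2..n}" "\<And>i. i \<in> {2..n} \<Longrightarrow> S \<noteq> {i}"
  shows "S \<in> whitehouse_vertices n"
proof -
  have fin: "finite S" using assms(1) finite_subset by blast
  have "card S \<noteq> 1" using assms(1,4) by (metis card_1_singletonE insert_subset)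
  moreover have "card S \<noteq> 0" using assms(2) fin by simp
  \<comment> \<open>\<open>{2..n}\<close> has \<open>n - 1\<close> elements, so a proper subset has
    at most \<open>n - 2\<close>.\<close>
  moreover have "card S < card {2..n}" using assms(1,3) by (intro psubset_card_mono) auto
  ultimately show ?thesis using assms(1) by (auto simp: whitehouse_vertices_def)
qed

lemma whitehouse_complex_iff:
  "F \<in> whitehouse_complex n \<longleftrightarrow> F \<subseteq> whitehouse_vertices n \<and> (\<forall>S\<in>F. \<forall>T\<in>F. compatible S T)"
  by (simp add: whitehouse_complex_def compatible_def)

lemma whitehouse_faceD:
  assumes "n \<ge> 3" "F \<in> whitehouse_complex n" "S \<in> F"
  shows "S \<subseteq> {2..n}" "S \<noteq> {}" "S \<noteq> {2..n}" "S \<noteq> {i}"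
proof -
  have "S \<in> whitehouse_vertices n" using assms(2,3) by (auto simp: whitehouse_complex_iff)
  then show "S \<subseteq> {2..n}" "S \<noteq> {}" "S \<noteq> {2..n}" "S \<noteq> {i}"
    by (rule whitehouse_vertexD[OF assms(1)])+
qed

lemma hierarchy_face_hierarchy:
  assumes n: "n \<ge> 3" and F: "F \<in> whitehouse_complex n"
  shows "hierarchy {2..n} (face_hierarchy n F)"
proof -
  note v = whitehouse_faceD[OF n F]
  have single: "compatible S {i}" "compatible {i} S" for S :: "nat set" and i
    by (auto simp: compatible_def)
  have top: "compatible S {2..n}" "compatible {2..n} S" if "S \<in> F" for S
    using v(1)[OF that] by (auto simp: compatible_def)
  have "compatible S T" if "S \<in> F" "T \<in> F" for S T
    using F that by (simp add: whitehouse_complex_iff)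
  then have "\<forall>S\<in>face_hierarchy n F. \<forall>T\<in>face_hierarchy n F. compatible S T"
    using single top by (auto simp: face_hierarchy_def compatible_def[of "{2..n}" "{2..n}"])
  moreover have "face_hierarchy n F \<subseteq> Pow {2..n} - {{}}"
    using v n by (auto simp: face_hierarchy_def)
  ultimately show ?thesis by (simp add: hierarchy_def face_hierarchy_def)
qed

lemma link_whitehouse_eq_refinements:
  assumes n: "n \<ge> 3" and F: "F \<in> whitehouse_complex n"
  shows "link (whitehouse_complex n) F = refinements {2..n} (face_hierarchy n F)"
proof (intro set_eqI iffI)
  have un: "face_hierarchy n F \<union> G = face_hierarchy n (F \<union> G)" for G
    by (auto simp: face_hierarchy_def)
  show "G \<in> refinements {2..n} (face_hierarchy n F)" if G: "G \<in> link (whitehouse_complex n) F" for G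
  proof -
    have FG: "F \<inter> G = {}" "F \<union> G \<in> whitehouse_complex n" using G by (auto simp: link_def)
    have "S \<notin> face_hierarchy n F" if "S \<in> G" for S
      using whitehouse_faceD(3,4)[OF n FG(2), of S] FG(1) that by (auto simp: face_hierarchy_def)
    then show ?thesis
      using hierarchy_face_hierarchy[OF n FG(2)] by (auto simp: refinements_def un)
  qed
  show "G \<in> link (whitehouse_complex n) F" if G: "G \<in> refinements {2..n} (face_hierarchy n F)" for G
  proof -
    have GH: "hierarchy {2..n} (face_hierarchy n F \<union> G)" "face_hierarchy n F \<inter> G = {}"
      using G by (auto simp: refinements_def)
    have "S \<in> whitehouse_vertices n" if "S \<in> G" for S
    proof (rule whitehouse_vertexI)
      show "S \<subseteq> {2..n}" "S \<noteq> {}" using GH(1) that by (auto simp: hierarchy_def)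
      show "S \<noteq> {2..n}" "\<And>i. i \<in> {2..n} \<Longrightarrow> S \<noteq> {i}"
        using GH(2) that unfolding face_hierarchy_def by blast+
    qed
    then have "F \<union> G \<subseteq> whitehouse_vertices n" using F by (auto simp: whitehouse_complex_iff)
    moreover have "compatible S T" if "S \<in> F \<union> G" "T \<in> F \<union> G" for S T
      using GH(1) that by (auto simp: hierarchy_def face_hierarchy_def)
    moreover have "F \<inter> G = {}" using GH(2) by (auto simp: face_hierarchy_def)
    ultimately show ?thesis by (auto simp: link_def whitehouse_complex_iff)
  qed
qed

text \<open>The two summands of \<open>forest_children\<close> count the children in
  \<open>F\<close> and the singletons standing for leaves; no member of \<open>F\<close> is a
  singleton, so nothing is counted twice.\<close>

lemma card_children_face_hierarchy:
  assumes n: "n \<ge> 3" and F: "F \<in> whitehouse_complex n" and T: "T = {2..n} \<or> T \<in> F"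
  shows "card (children (face_hierarchy n F) T) = forest_children F T"
proof -
  let ?A = "{U\<in>F. U \<subset> T \<and> \<not> (\<exists>W\<in>F. U \<subset> W \<and> W \<subset> T)}"
  let ?B = "{i\<in>T. \<not> (\<exists>U\<in>F. i \<in> U \<and> U \<subset> T)}"
  note vF = whitehouse_faceD(1,2,4)[OF n F]
  have T': "T \<subseteq> {2..n}" "\<And>i. T \<noteq> {i}"
  proof -
    show "T \<subseteq> {2..n}" using T vF(1) by blast
    have "card {2..n} \<noteq> 1" using n by simp
    then show "T \<noteq> {i}" for i using T vF(3) by (metis is_singletonI is_singleton_altdef)
  qed
  have mem: "W \<in> face_hierarchy n F \<longleftrightarrow> W = {2..n} \<or> W \<in> F \<or> (\<exists>i\<in>{2..n}. W = {i})" for W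
    by (auto simp: face_hierarchy_def)
  \<comment> \<open>The adjoined sets never come in between: a singleton has no nonempty proper
    subset, and \<open>{2..n}\<close> is not properly inside \<open>T\<close>.\<close>
  have between: "(\<exists>W\<in>face_hierarchy n F. U \<subset> W \<and> W \<subset> T) \<longleftrightarrow> (\<exists>W\<in>F. U \<subset> W \<and> W \<subset> T)"
    if "U \<noteq> {}" for U
    using that T'(1) unfolding Bex_def mem by blast
  have "children (face_hierarchy n F) T = ?A \<union> (\<lambda>i. {i}) ` ?B"
  proof (intro set_eqI iffI)
    fix U assume U: "U \<in> children (face_hierarchy n F) T"
    then have U': "U \<subset> T" "U \<noteq> {2..n}" "U = {2..n} \<or> U \<in> F \<or> (\<exists>i\<in>{2..n}. U = {i})"
      using T'(1) by (auto simp: children_def mem)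
    show "U \<in> ?A \<union> (\<lambda>i. {i}) ` ?B"
    proof (cases "U \<in> F")
      case True
      then show ?thesis using U between[OF vF(2)[OF True]] by (auto simp: children_def)
    next
      case False
      then obtain i where i: "U = {i}" using U' by blast
      have sub: "F \<subseteq> face_hierarchy n F" by (auto simp: mem)
      have "\<not> (\<exists>W\<in>F. {i} \<subset> W \<and> W \<subset> T)"
        using U sub unfolding i children_def by blast
      moreover have "{i} \<subset> W" if "W \<in> F" "i \<in> W" for W using that vF(3)[OF that(1), of i] by blast
      ultimately have "i \<in> ?B" using U'(1) i by blast
      then show ?thesis using i by blast
    qed
  next
    fix U assume "U \<in> ?A \<union> (\<lambda>i. {i}) ` ?B"
    then show "U \<in> children (face_hierarchy n F) T"
    proof
      assume A: "U \<in> ?A"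
      then have "\<not> (\<exists>W\<in>face_hierarchy n F. U \<subset> W \<and> W \<subset> T)" using between[OF vF(2), of U] by blast
      then show ?thesis using A by (simp add: children_def mem)
    next
      assume "U \<in> (\<lambda>i. {i}) ` ?B"
      then obtain i where i: "U = {i}" "i \<in> T" "\<not> (\<exists>W\<in>F. i \<in> W \<and> W \<subset> T)" by blast
      have "\<not> (\<exists>W\<in>F. U \<subset> W \<and> W \<subset> T)" using i by blast
      moreover have "U \<in> face_hierarchy n F" using i T'(1) by (auto simp: mem)
      moreover have "U \<subset> T" using i T'(2)[of i] by blast
      moreover have "\<not> (\<exists>W\<in>face_hierarchy n F. U \<subset> W \<and> W \<subset> T)"
        using between[of U] i(1) calculation(1) by blast
      ultimately show ?thesis unfolding children_def by blast
    qed
  qed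
  moreover have "?A \<inter> (\<lambda>i. {i}) ` ?B = {}" using vF(3) by blast
  moreover have "finite F" by (rule finite_subset[of F "Pow {2..n}"]) (use vF(1) in auto)
  then have "finite ?A" by simp
  moreover have "finite ?B" using T'(1) finite_subset[of T "{2..n}"] by simp
  moreover have "card ((\<lambda>i. {i}) ` ?B) = card ?B" by (intro card_image) (auto simp: inj_on_def)
  ultimately show ?thesis unfolding forest_children_def by (simp add: card_Un_disjoint)
qed

text \<open>Adjoining \<open>{2..n}\<close> turns the forest into a tree whose new root has the old
  roots as children.\<close>

lemma forest_components_eq_children:
  assumes n: "n \<ge> 3" and F: "F \<in> whitehouse_complex n"
  shows "forest_components n F = forest_children F {2..n}"
proof -
  have v: "S \<subset> {2..n}" if "S \<in> F" for S
    using whitehouse_faceD(1,3)[OF n F that] by blast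
  have "{S\<in>F. \<not> (\<exists>T\<in>F. S \<subset> T)} = {U\<in>F. U \<subset> {2..n} \<and> \<not> (\<exists>W\<in>F. U \<subset> W \<and> W \<subset> {2..n})}"
    using v by blast
  moreover have "{i\<in>{2..n}. \<forall>S\<in>F. i \<notin> S} = {i\<in>{2..n}. \<not> (\<exists>U\<in>F. i \<in> U \<and> U \<subset> {2..n})}"
    using v by blast
  ultimately show ?thesis unfolding forest_components_def forest_children_def by simp
qed

theorem mainTheorem13:
  fixes n :: nat and F :: "nat set set"
  assumes "n \<ge> 3" and "F \<in> whitehouse_complex n"
  shows "is_wedge_of_spheres (link (whitehouse_complex n) F)
           (fact (forest_components n F - 1) * (\<Prod>T\<in>F. fact (forest_children F T - 1)))
           (int n - 4 - int (card F))"
proof -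
  note n = assms(1) and F = assms(2)
  let ?H = "face_hierarchy n F" and ?V = "{2..n}"
  let ?k = "fact (forest_components n F - 1) * (\<Prod>T\<in>F. fact (forest_children F T - 1)) :: nat"
  define L where "L = link (whitehouse_complex n) F"
  define r where "r = 2 * card ?V - 1 - card ?H"
  have V: "finite ?V" by simp
  have H: "hierarchy ?V ?H" by (rule hierarchy_face_hierarchy[OF n F])
  have L: "L = refinements ?V ?H" unfolding L_def by (rule link_whitehouse_eq_refinements[OF n F])
  note v = whitehouse_faceD(1,3,4)[OF n F]
  have finF: "finite F" by (rule finite_subset[of F "Pow ?V"]) (use v in auto)
  let ?S = "(\<lambda>i. {i}) ` ?V"
  have "card ?V \<noteq> 1" using n by simp
  then have "?V \<noteq> {i}" for i by (metis is_singletonI is_singleton_altdef)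
  then have dis: "?V \<notin> F \<union> ?S" "F \<inter> ?S = {}" using v by blast+
  have "card ?S = card ?V" by (intro card_image) (auto simp: inj_on_def)
  then have card_H: "card ?H = card F + n"
    using dis finF n by (simp add: face_hierarchy_def card_Un_disjoint)
  \<comment> \<open>\<open>2 * (n - 1) - 1 - (card F + n)\<close> is \<open>n - 3 - card F\<close>,
    one more than the dimension; the bound on nodes shows that the truncated subtraction is
    exact.\<close>
  have r: "int r = int n - 3 - int (card F)"
    using hierarchy_card_le[OF V H] card_H n by (simp add: r_def)
  have "(\<Prod>T\<in>?H. fact (card (children ?H T) - 1) :: nat)
      = fact (card (children ?H ?V) - 1) *
        ((\<Prod>T\<in>F. fact (card (children ?H T) - 1)) * (\<Prod>T\<in>?S. fact (card (children ?H T) - 1)))"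
    using dis finF by (subst (1) face_hierarchy_def) (simp add: prod.union_disjoint)
  also have "(\<Prod>T\<in>?S. fact (card (children ?H T) - 1) :: nat) = 1"
    using children_singleton[OF V H] by (intro prod.neutral) auto
  also have "(\<Prod>T\<in>F. fact (card (children ?H T) - 1) :: nat) = (\<Prod>T\<in>F. fact (forest_children F T - 1))"
    using card_children_face_hierarchy[OF n F] by (intro prod.cong) auto
  also have "card (children ?H ?V) = forest_components n F"
    using card_children_face_hierarchy[OF n F] forest_components_eq_children[OF n F] by simp
  finally have coll: "collapsible_mod L ?k r"
    using collapsible_mod_refinements[OF V H] by (simp add: L r_def)
  have empty: "{} \<in> L" using H by (simp add: L refinements_def)
  have "\<Union>L \<subseteq> Pow ?V" by (auto simp: L refinements_def hierarchy_def)
  then have "finite (\<Union>L)" by (rule finite_subset) simp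
  then have cL: "simplicial_complex L"
    unfolding simplicial_complex_def L using refinements_mono[OF _ H] by blast
  show ?thesis
  proof (cases r)
    case 0
    then have "L = {{}} \<and> ?k = 1"
      using collapsible_mod_0[OF _ empty] coll simplicial_complexD(3)[OF cL] by blast
    moreover have "int n - 4 - int (card F) = -1" using r 0 by simp
    ultimately show ?thesis by (simp add: is_wedge_of_spheres_def flip: L_def)
  next
    case (Suc d)
    then have "int n - 4 - int (card F) = int d" using r by simp
    moreover have "realization L homotopy_equivalent_space wedge_of_spheres ?k d"
      using collapsible_mod_imp_wedge[OF cL empty] coll Suc by blast
    ultimately show ?thesis by (simp add: is_wedge_of_spheres_def flip: L_def)
  qed
qed

end
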